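(* Let $\mu\in\mathcal P$ and let $(\mu_k)_{k\in\mathbb N}$ be a sequence in $\mathcal P$ such that $\mathcal W(\mu_k,\mu)\to0$ as $k\to\infty$. Consider a filtered probability space supporting a Brownian motion $W$ and a sequence of progressively measurable $\mathcal U$-valued processes $u_k$, $k\in\mathbb N$. Suppose that $\xi^{u_k;\mu_k}$ and $\xi^{u_k;\mu}$, $k\in\mathbb N$, are solutions to the equation $$d\xi_s(\varphi)=\big(\xi_s(\varphi h(u_s,\cdot))-\xi_s(\varphi)\xi_s(h(u_s,\cdot))\big)dW_s,\quad\varphi\in C_b,$$ for $u=u_k$ and the initial conditions $\mu_k$ and $\mu$, respectively. Then the solutions are unique (up to indistinguishability) and for any $t>0$, $$\mathbb E\big|\xi^{u_k;\mu_k}_t(f)-\xi^{u_k;\mu}_t(f)\big|\xrightarrow[k\to\infty]{}0,\quad\text{for all }f\in C_b.$$ In particular, (for any $t>0$) there exists a subsequence, still indexed by $k$, along which $$\mathcal W\big(\xi^{u_k;\mu_k}_t,\xi^{u_k;\mu}_t\big)\xrightarrow[k\to\infty]{}0\quad\text{a.s.}$$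
   Context: $\mu_0$ is a fixed probability measure on $\mathbb R$ with compact support, and $R>0$ is such that $\operatorname{supp}(\mu_0)\subset(-R,R)$. $\mathcal P$ is the set of Borel probability measures on $\mathbb R$ whose support is contained in $\operatorname{supp}(\mu_0)$, with the topology of weak convergence, metrised by the Wasserstein-1 distance $\mathcal W$. $C_b$ is the set of bounded continuous functions on $\mathbb R$, and $\mu(\varphi):=\int\varphi\,d\mu$. Fix $K>0$ and a set $\mathcal U\subseteq\{v=(v_0,v_1,\dots): v_i\in\mathbb R,\ \sum_{i=0}^\infty(R^iv_i)^2\le K\}$, closed in the product topology and equipped with the subspace topology of the product topology. Set $h(v,x):=\sum_{i=0}^\infty v_ix^i$ for $v\in\mathcal U$, $x\in\operatorname{supp}(\mu_0)$. A solution of the equation is a continuous $\mathcal P$-valued measure-valued martingale $\xi$ (i.e. $\xi$ is adapted, has weakly continuous paths, and $\xi(\varphi)$ is a martingale for each $\varphi\in C_b$) satisfying the displayed equation for every $\varphi\in C_b$. Filtered probability spaces satisfy the usual conditions, and $W$ is a Brownian motion with respect to the given filtration. *)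

theory Defs
  imports "HOL-Probability.Probability"
begin

section \<open>Probability measures on the line\<close>

definition measure_support :: "'x::topological_space measure \<Rightarrow> 'x set" where
  "measure_support \<mu> = {x. \<forall>U. open U \<longrightarrow> x \<in> U \<longrightarrow> emeasure \<mu> U > 0}"

definition prob_measures_within :: "real measure \<Rightarrow> real measure set" where
  "prob_measures_within \<mu>0 =
     {\<nu>. prob_space \<nu> \<and> sets \<nu> = sets borel \<and> measure_support \<nu> \<subseteq> measure_support \<mu>0}"

definition bounded_continuous :: "(real \<Rightarrow> real) set" where
  "bounded_continuous = {\<phi>. continuous_on UNIV \<phi> \<and> bounded (range \<phi>)}"

definition couplings :: "real measure \<Rightarrow> real measure \<Rightarrow> (real \<times> real) measure set" where
  "couplings \<mu> \<nu> =
     {\<pi>. sets \<pi> = sets (borel \<Otimes>\<^sub>M borel) \<and> distr \<pi> borel fst = \<mu> \<and> distr \<pi> borel snd = \<nu>}"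

definition wasserstein1 :: "real measure \<Rightarrow> real measure \<Rightarrow> ennreal" where
  "wasserstein1 \<mu> \<nu> = (INF \<pi>\<in>couplings \<mu> \<nu>. \<integral>\<^sup>+ z. ennreal \<bar>fst z - snd z\<bar> \<partial>\<pi>)"


section \<open>Filtered probability spaces and Brownian motion\<close>

text \<open>Time is \<open>[0, \<infinity>)\<close>, represented inside \<^typ>\<open>real\<close>: nothing is
  required of the filtration or of any process at negative times.\<close>

definition usual_filtered_prob_space :: "'a measure \<Rightarrow> (real \<Rightarrow> 'a measure) \<Rightarrow> bool" where
  "usual_filtered_prob_space M F \<longleftrightarrow>
     prob_space M \<and>
     (\<forall>t\<ge>0. subalgebra M (F t)) \<and>
     (\<forall>s\<ge>0. \<forall>t\<ge>s. sets (F s) \<subseteq> sets (F t)) \<and>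
     (\<forall>t\<ge>0. sets (F t) = (\<Inter>s\<in>{t<..}. sets (F s))) \<and>
     (\<forall>N\<in>null_sets M. \<forall>A\<subseteq>N. A \<in> sets (F 0))"

definition adapted_to :: "(real \<Rightarrow> 'a measure) \<Rightarrow> 'b measure \<Rightarrow> (real \<Rightarrow> 'a \<Rightarrow> 'b) \<Rightarrow> bool" where
  "adapted_to F N X \<longleftrightarrow> (\<forall>t\<ge>0. X t \<in> measurable (F t) N)"

definition progressively_measurable ::
    "(real \<Rightarrow> 'a measure) \<Rightarrow> 'b measure \<Rightarrow> (real \<Rightarrow> 'a \<Rightarrow> 'b) \<Rightarrow> bool" where
  "progressively_measurable F N X \<longleftrightarrow>
     (\<forall>t\<ge>0. (\<lambda>(s, \<omega>). X s \<omega>) \<in> measurable (restrict_space borel {0..t} \<Otimes>\<^sub>M F t) N)"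

definition martingale :: "'a measure \<Rightarrow> (real \<Rightarrow> 'a measure) \<Rightarrow> (real \<Rightarrow> 'a \<Rightarrow> real) \<Rightarrow> bool" where
  "martingale M F X \<longleftrightarrow>
     adapted_to F borel X \<and>
     (\<forall>t\<ge>0. integrable M (X t)) \<and>
     (\<forall>s\<ge>0. \<forall>t\<ge>s. AE \<omega> in M. real_cond_exp M (F s) (X t) \<omega> = X s \<omega>)"

definition brownian_motion :: "'a measure \<Rightarrow> (real \<Rightarrow> 'a measure) \<Rightarrow> (real \<Rightarrow> 'a \<Rightarrow> real) \<Rightarrow> bool" where
  "brownian_motion M F W \<longleftrightarrow>
     adapted_to F borel W \<and>
     (AE \<omega> in M. W 0 \<omega> = 0) \<and>
     (AE \<omega> in M. continuous_on {0..} (\<lambda>t. W t \<omega>)) \<and>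
     (\<forall>s\<ge>0. \<forall>t>s.
        distributed M lborel (\<lambda>\<omega>. W t \<omega> - W s \<omega>) (normal_density 0 (sqrt (t - s))) \<and>
        prob_space.indep_set M (sets (F s))
          (sets (vimage_algebra (space M) (\<lambda>\<omega>. W t \<omega> - W s \<omega>) borel)))"


section \<open>The Ito integral\<close>

text \<open>The triple \<open>(n, \<tau>, Z)\<close> encodes the simple process
  \<open>\<Sum>i<n. Z i * indicator {\<tau> i<..\<tau> (Suc i)}\<close>.\<close>

definition simple_integrand ::
    "(real \<Rightarrow> 'a measure) \<Rightarrow> nat \<times> (nat \<Rightarrow> real) \<times> (nat \<Rightarrow> 'a \<Rightarrow> real) \<Rightarrow> bool" where
  "simple_integrand F = (\<lambda>(n, \<tau>, Z).
     0 \<le> \<tau> 0 \<and> (\<forall>i<n. \<tau> i \<le> \<tau> (Suc i)) \<and>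
     (\<forall>i<n. Z i \<in> borel_measurable (F (\<tau> i)) \<and> (\<exists>C. \<forall>\<omega>\<in>space (F (\<tau> i)). \<bar>Z i \<omega>\<bar> \<le> C)))"

definition simple_process ::
    "nat \<times> (nat \<Rightarrow> real) \<times> (nat \<Rightarrow> 'a \<Rightarrow> real) \<Rightarrow> real \<Rightarrow> 'a \<Rightarrow> real" where
  "simple_process = (\<lambda>(n, \<tau>, Z) s \<omega>. \<Sum>i<n. Z i \<omega> * indicator {\<tau> i<..\<tau> (Suc i)} s)"

definition simple_integral ::
    "(real \<Rightarrow> 'a \<Rightarrow> real) \<Rightarrow> nat \<times> (nat \<Rightarrow> real) \<times> (nat \<Rightarrow> 'a \<Rightarrow> real) \<Rightarrow> real \<Rightarrow> 'a \<Rightarrow> real" where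
  "simple_integral W = (\<lambda>(n, \<tau>, Z) t \<omega>.
     \<Sum>i<n. Z i \<omega> * (W (min (\<tau> (Suc i)) t) \<omega> - W (min (\<tau> i) t) \<omega>))"

text \<open>\<open>I\<close> is a continuous version of \<open>\<integral>\<^sub>0\<^sup>t H dW\<close>, for progressively measurable \<open>H\<close> with
  \<open>E (\<integral>\<^sub>0\<^sup>t H\<^sup>2 ds) < \<infinity>\<close> for all \<open>t\<close>: the \<open>L\<^sup>2\<close>-limit of the integrals of simple processes
  approximating \<open>H\<close> in \<open>L\<^sup>2([0, t] \<times> \<Omega>)\<close>. By the Ito isometry the limit does not depend on the
  approximating sequence, and every such \<open>H\<close> has one.\<close>

definition is_ito_integral ::
    "'a measure \<Rightarrow> (real \<Rightarrow> 'a measure) \<Rightarrow> (real \<Rightarrow> 'a \<Rightarrow> real) \<Rightarrow>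
     (real \<Rightarrow> 'a \<Rightarrow> real) \<Rightarrow> (real \<Rightarrow> 'a \<Rightarrow> real) \<Rightarrow> bool" where
  "is_ito_integral M F W H I \<longleftrightarrow>
     progressively_measurable F borel H \<and>
     (\<forall>t\<ge>0. (\<integral>\<^sup>+ \<omega>. (\<integral>\<^sup>+ s\<in>{0..t}. ennreal ((H s \<omega>)\<^sup>2) \<partial>lborel) \<partial>M) < \<infinity>) \<and>
     adapted_to F borel I \<and>
     (AE \<omega> in M. continuous_on {0..} (\<lambda>t. I t \<omega>)) \<and>
     (\<forall>t\<ge>0. \<exists>S. (\<forall>n. simple_integrand F (S n)) \<and>
        (\<lambda>n. \<integral>\<^sup>+ \<omega>. (\<integral>\<^sup>+ s\<in>{0..t}. ennreal ((simple_process (S n) s \<omega> - H s \<omega>)\<^sup>2) \<partial>lborel) \<partial>M)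
          \<longlonglongrightarrow> 0 \<and>
        (\<lambda>n. \<integral>\<^sup>+ \<omega>. ennreal ((simple_integral W (S n) t \<omega> - I t \<omega>)\<^sup>2) \<partial>M) \<longlonglongrightarrow> 0)"


section \<open>The controlled equation\<close>

text \<open>The topology on \<^typ>\<open>nat \<Rightarrow> real\<close> is the product topology, so \<^term>\<open>closed U\<close> and
  \<^term>\<open>restrict_space borel U\<close> refer to it.\<close>

definition control_set :: "real \<Rightarrow> real \<Rightarrow> (nat \<Rightarrow> real) set \<Rightarrow> bool" where
  "control_set R K U \<longleftrightarrow>
     U \<subseteq> {v. summable (\<lambda>i. (R ^ i * v i)\<^sup>2) \<and> (\<Sum>i. (R ^ i * v i)\<^sup>2) \<le> K} \<and> closed U"

text \<open>Only the values at \<open>x\<close> in the support of \<open>\<mu>0\<close>, where the series converges, matter below.\<close>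

definition control_fun :: "(nat \<Rightarrow> real) \<Rightarrow> real \<Rightarrow> real" where
  "control_fun v x = (\<Sum>i. v i * x ^ i)"

text \<open>Adaptedness uses \<^term>\<open>prob_algebra borel\<close>, which is generated by the evaluations
  \<open>\<nu> \<mapsto> \<nu> A\<close> and is the Borel sigma-algebra of the weak topology. As the time domain is metric,
  continuity of a path in the weak topology means continuity of its integrals against bounded
  continuous functions.\<close>

definition continuous_mvm ::
    "'a measure \<Rightarrow> (real \<Rightarrow> 'a measure) \<Rightarrow> real measure set \<Rightarrow> (real \<Rightarrow> 'a \<Rightarrow> real measure) \<Rightarrow> bool" where
  "continuous_mvm M F P \<xi> \<longleftrightarrow>
     (\<forall>t\<ge>0. \<forall>\<omega>\<in>space M. \<xi> t \<omega> \<in> P) \<and>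
     adapted_to F (prob_algebra borel) \<xi> \<and>
     (\<forall>\<omega>\<in>space M. \<forall>\<phi>\<in>bounded_continuous. continuous_on {0..} (\<lambda>t. \<integral>x. \<phi> x \<partial>(\<xi> t \<omega>))) \<and>
     (\<forall>\<phi>\<in>bounded_continuous. martingale M F (\<lambda>t \<omega>. \<integral>x. \<phi> x \<partial>(\<xi> t \<omega>)))"

definition mvm_solution ::
    "'a measure \<Rightarrow> (real \<Rightarrow> 'a measure) \<Rightarrow> (real \<Rightarrow> 'a \<Rightarrow> real) \<Rightarrow> real measure \<Rightarrow>
     (real \<Rightarrow> 'a \<Rightarrow> nat \<Rightarrow> real) \<Rightarrow> real measure \<Rightarrow> (real \<Rightarrow> 'a \<Rightarrow> real measure) \<Rightarrow> bool" where
  "mvm_solution M F W \<mu>0 u \<mu> \<xi> \<longleftrightarrow>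
     continuous_mvm M F (prob_measures_within \<mu>0) \<xi> \<and>
     (AE \<omega> in M. \<xi> 0 \<omega> = \<mu>) \<and>
     (\<forall>\<phi>\<in>bounded_continuous.
        is_ito_integral M F W
          (\<lambda>s \<omega>. (\<integral>x. \<phi> x * control_fun (u s \<omega>) x \<partial>(\<xi> s \<omega>))
                  - (\<integral>x. \<phi> x \<partial>(\<xi> s \<omega>)) * (\<integral>x. control_fun (u s \<omega>) x \<partial>(\<xi> s \<omega>)))
          (\<lambda>t \<omega>. (\<integral>x. \<phi> x \<partial>(\<xi> t \<omega>)) - (\<integral>x. \<phi> x \<partial>(\<xi> 0 \<omega>))))"

definition indistinguishable ::
    "'a measure \<Rightarrow> (real \<Rightarrow> 'a \<Rightarrow> 'b) \<Rightarrow> (real \<Rightarrow> 'a \<Rightarrow> 'b) \<Rightarrow> bool" where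
  "indistinguishable M X Y \<longleftrightarrow> (AE \<omega> in M. \<forall>t\<ge>0. X t \<omega> = Y t \<omega>)"

end

theory Submission
  imports Defs
begin

text \<open>Let \<open>d\<^sub>n(t)\<close> be the difference of the \<open>n\<close>-th moments, divided by \<open>\<rho> ^ n\<close>, of two solutions driven by the
  same control, where \<open>supp \<mu>0 \<subseteq> [-r, r]\<close> and \<open>r < \<rho> < R\<close>. Since the control is a power series with coefficients
  of size \<open>R ^ (-i)\<close>, the volatility of the \<open>n\<close>-th scaled moment depends on the higher moments only through
  the weights \<open>(\<rho> / R) ^ i\<close>. So the Ito isometry yields a closed Gronwall inequality for
  \<open>sup\<^sub>n E d\<^sub>n(t)\<^sup>2\<close>, with a constant independent of the control. The initial value is controlled by the
  Wasserstein distance because \<open>r < \<rho>\<close> makes the scaled powers uniformly Lipschitz. Uniqueness follows since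
  moments determine measures on a compact set, and the convergence statements follow from Weierstrass
  approximation.\<close>

section \<open>Increments of Brownian motion and the Ito isometry for elementary processes\<close>

text \<open>The hierarchy does not close on finitely many moments: multiplying a test function by
  the control function raises its degree, so each volatility involves all later moments. A bound
  uniform in the moment index is unaffected by this shift and can be propagated. It must not depend
  on the control either, because the controls vary with \<open>k\<close> and neither sequence of
  solutions has to converge; only the distance between two solutions under one control is estimated.
  Test functions must be bounded on the whole line, hence powers clipped outside
  \<open>[-r, r]\<close>. Stochastic integrals are known only through simple approximations in mean
  square, so the isometry is proved for simple processes and carried over by triangle inequalities.
  This costs a constant factor, which a Gronwall argument tolerates. Almost sure convergence needs
  one subsequence for all moments at once. It comes from a single geometrically weighted sum of
  squared moment differences, whose expectation tends to zero.\<close>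

lemma has_bochner_integral_swap_factors:
  fixes X Y :: "'a \<Rightarrow> real"
  shows "has_bochner_integral M (\<lambda>\<omega>. X \<omega> * Y \<omega>) c \<Longrightarrow> has_bochner_integral M (\<lambda>\<omega>. Y \<omega> * X \<omega>) c"
  by (simp add: mult.commute)

section \<open>Increments of \<open>W\<close> against coefficients known at an earlier time\<close>

locale brownian_filtration =
  fixes M :: "'a measure" and F :: "real \<Rightarrow> 'a measure" and W :: "real \<Rightarrow> 'a \<Rightarrow> real"
  assumes filtration: "usual_filtered_prob_space M F"
    and brownian: "brownian_motion M F W"
begin

sublocale prob_space M
  using filtration by (simp add: usual_filtered_prob_space_def)

lemma subalgebra_filtration: "0 \<le> t \<Longrightarrow> subalgebra M (F t)"
  using filtration by (simp add: usual_filtered_prob_space_def)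

lemma space_filtration: "0 \<le> t \<Longrightarrow> space (F t) = space M"
  using subalgebra_filtration by (simp add: subalgebra_def)

lemma measurable_filtrationD: "0 \<le> t \<Longrightarrow> f \<in> measurable (F t) N \<Longrightarrow> f \<in> measurable M N"
  using subalgebra_filtration measurable_from_subalg by blast

lemma measurable_filtration_mono:
  assumes "0 \<le> s" "s \<le> t" "f \<in> measurable (F s) N"
  shows "f \<in> measurable (F t) N"
proof -
  have "subalgebra (F t) (F s)"
    using filtration[unfolded usual_filtered_prob_space_def] assms(1,2) space_filtration
    unfolding subalgebra_def by (metis order_trans)
  then show ?thesis
    using assms(3) measurable_from_subalg by blast
qed

lemma brownian_measurable: "0 \<le> t \<Longrightarrow> W t \<in> borel_measurable (F t)"
  using brownian by (simp add: brownian_motion_def adapted_to_def)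

lemma increment_distributed:
  "0 \<le> s \<Longrightarrow> s < t \<Longrightarrow>
    distributed M lborel (\<lambda>\<omega>. W t \<omega> - W s \<omega>) (normal_density 0 (sqrt (t - s)))"
  using brownian by (simp add: brownian_motion_def)

text \<open>The case \<open>s = t\<close> is treated apart, here and below, because
  \<open>brownian_motion\<close> prescribes the normal law only for strictly ordered times, where
  the variance is positive.\<close>

lemma increment_integral:
  assumes "0 \<le> s" "s \<le> t"
  shows "has_bochner_integral M (\<lambda>\<omega>. W t \<omega> - W s \<omega>) 0"
proof (cases "s = t")
  case False
  then have D: "distributed M lborel (\<lambda>\<omega>. W t \<omega> - W s \<omega>) (normal_density 0 (sqrt (t - s)))"
    and pos: "0 < sqrt (t - s)"
    using assms increment_distributed by auto
  have "integrable M (\<lambda>\<omega>. W t \<omega> - W s \<omega>)"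
    using distributed_integrable[OF D, of "\<lambda>x. x"] integrable_normal_moment[OF pos, of 0 1] by simp
  then show ?thesis
    using normal_distributed_expectation[OF pos D] by (simp add: has_bochner_integral_iff)
qed (auto simp: has_bochner_integral_zero)

lemma increment_square_integral:
  assumes "0 \<le> s" "s \<le> t"
  shows "has_bochner_integral M (\<lambda>\<omega>. (W t \<omega> - W s \<omega>)\<^sup>2) (t - s)"
proof (cases "s = t")
  case False
  then have D: "distributed M lborel (\<lambda>\<omega>. W t \<omega> - W s \<omega>) (normal_density 0 (sqrt (t - s)))"
    and pos: "0 < sqrt (t - s)"
    using assms increment_distributed by auto
  have "integrable M (\<lambda>\<omega>. (W t \<omega> - W s \<omega>)\<^sup>2)"
    using distributed_integrable[OF D, of "\<lambda>x. x\<^sup>2"] integrable_normal_moment[OF pos, of 0 2] by simp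
  then show ?thesis
    using normal_distributed_variance[OF pos D] normal_distributed_expectation[OF pos D] assms
    by (simp add: has_bochner_integral_iff)
qed (auto simp: has_bochner_integral_zero)

text \<open>Independence passes to smaller sigma-algebras: the one generated by \<open>Y\<close>
  lies in \<open>F s\<close>, the one generated by \<open>g\<close> of the increment lies in that of
  the increment. The function \<open>g\<close> lets one lemma serve both the increment and its
  square.\<close>

lemma increment_indep_var:
  assumes "0 \<le> s" "s < t" and Y: "Y \<in> borel_measurable (F s)" and g: "g \<in> borel_measurable borel"
  shows "indep_var borel Y borel (\<lambda>\<omega>. g (W t \<omega> - W s \<omega>) :: real)"
proof -
  let ?D = "\<lambda>\<omega>. W t \<omega> - W s \<omega>"
  have D[measurable]: "?D \<in> borel_measurable M"
    using assms measurable_filtrationD[OF _ brownian_measurable, of s] measurable_filtrationD[OF _ brownian_measurable, of t]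
    by simp
  have YM: "Y \<in> borel_measurable M"
    using assms measurable_filtrationD by blast
  have ind: "indep_set (sets (F s)) (sets (vimage_algebra (space M) ?D borel))"
    using brownian assms by (simp add: brownian_motion_def)
  have "sigma_sets (space M) {Y -` A \<inter> space M |A. A \<in> sets borel} \<subseteq> sets (F s)"
  proof -
    have "{Y -` A \<inter> space M |A. A \<in> sets borel} \<subseteq> sets (F s)"
      using measurable_sets[OF Y] space_filtration[OF assms(1)] by auto
    from sets.sigma_sets_subset[OF this] show ?thesis
      by (simp add: space_filtration[OF assms(1)])
  qed
  moreover have "sigma_sets (space M) {(\<lambda>\<omega>. g (?D \<omega>)) -` A \<inter> space M |A. A \<in> sets borel}
      \<subseteq> sets (vimage_algebra (space M) ?D borel)"
  proof -
    have "(\<lambda>\<omega>. g (?D \<omega>)) \<in> measurable (vimage_algebra (space M) ?D borel) borel"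
      by (rule measurable_compose[OF measurable_vimage_algebra1 g]) auto
    from measurable_sets[OF this]
    have "{(\<lambda>\<omega>. g (?D \<omega>)) -` A \<inter> space M |A. A \<in> sets borel}
        \<subseteq> sets (vimage_algebra (space M) ?D borel)"
      by auto
    from sets.sigma_sets_subset[OF this] show ?thesis
      by simp
  qed
  ultimately have "indep_set (sigma_sets (space M) {Y -` A \<inter> space M |A. A \<in> sets borel})
      (sigma_sets (space M) {(\<lambda>\<omega>. g (?D \<omega>)) -` A \<inter> space M |A. A \<in> sets borel})"
    using ind unfolding indep_set_def
    by (elim indep_sets_mono_sets) (auto split: bool.split)
  then show ?thesis
    unfolding indep_var_eq using YM g by (auto intro: measurable_compose[OF D])
qed

text \<open>Independence factors the expectation, and the increment has mean zero. This removes the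
  cross terms over disjoint time intervals in the isometry.\<close>

lemma past_times_increment:
  assumes "0 \<le> s" "s \<le> t" "Y \<in> borel_measurable (F s)" "integrable M Y"
  shows "has_bochner_integral M (\<lambda>\<omega>. Y \<omega> * (W t \<omega> - W s \<omega>)) 0"
proof (cases "s = t")
  case False
  then have ind: "indep_var borel Y borel (\<lambda>\<omega>. W t \<omega> - W s \<omega>)"
    using increment_indep_var[of s t Y "\<lambda>x. x"] assms by simp
  have "integrable M (\<lambda>\<omega>. W t \<omega> - W s \<omega>)" "expectation (\<lambda>\<omega>. W t \<omega> - W s \<omega>) = 0"
    using increment_integral[of s t] assms by (auto simp: has_bochner_integral_iff)
  then show ?thesis
    using indep_var_integrable[OF ind] indep_var_lebesgue_integral[OF ind] assms(4)
    by (simp add: has_bochner_integral_iff)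
qed (auto simp: has_bochner_integral_zero)

lemma past_times_increment_square:
  assumes "0 \<le> s" "s \<le> t" "Y \<in> borel_measurable (F s)" "integrable M Y"
  shows "has_bochner_integral M (\<lambda>\<omega>. Y \<omega> * (W t \<omega> - W s \<omega>)\<^sup>2) (expectation Y * (t - s))"
proof (cases "s = t")
  case False
  then have ind: "indep_var borel Y borel (\<lambda>\<omega>. (W t \<omega> - W s \<omega>)\<^sup>2)"
    using increment_indep_var[of s t Y "\<lambda>x. x\<^sup>2"] assms by simp
  have "integrable M (\<lambda>\<omega>. (W t \<omega> - W s \<omega>)\<^sup>2)" "expectation (\<lambda>\<omega>. (W t \<omega> - W s \<omega>)\<^sup>2) = t - s"
    using increment_square_integral[of s t] assms by (auto simp: has_bochner_integral_iff)
  then show ?thesis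
    using indep_var_integrable[OF ind] indep_var_lebesgue_integral[OF ind] assms(4)
    by (simp add: has_bochner_integral_iff)
qed (auto simp: has_bochner_integral_zero)

text \<open>The admissible coefficients of a simple process on an interval that starts at
  \<open>a\<close>. Boundedness makes multiplication by a coefficient preserve
  integrability.\<close>

definition bounded_past :: "real \<Rightarrow> ('a \<Rightarrow> real) \<Rightarrow> bool" where
  "bounded_past a Z \<longleftrightarrow> Z \<in> borel_measurable (F a) \<and> (\<exists>C. \<forall>\<omega>\<in>space M. \<bar>Z \<omega>\<bar> \<le> C)"

lemma bounded_past_mult:
  assumes "bounded_past a Y" "bounded_past a Z"
  shows "bounded_past a (\<lambda>\<omega>. Y \<omega> * Z \<omega>)"
proof -
  obtain C D where "\<And>\<omega>. \<omega> \<in> space M \<Longrightarrow> \<bar>Y \<omega>\<bar> \<le> C" "\<And>\<omega>. \<omega> \<in> space M \<Longrightarrow> \<bar>Z \<omega>\<bar> \<le> D"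
    using assms unfolding bounded_past_def by blast
  then have "\<bar>Y \<omega> * Z \<omega>\<bar> \<le> C * D" if "\<omega> \<in> space M" for \<omega>
    using that by (metis abs_ge_zero abs_mult mult_mono order_trans)
  then show ?thesis
    using assms unfolding bounded_past_def by (auto intro!: exI[of _ "C * D"])
qed

lemma bounded_past_mono: "0 \<le> a \<Longrightarrow> a \<le> b \<Longrightarrow> bounded_past a Z \<Longrightarrow> bounded_past b Z"
  unfolding bounded_past_def using measurable_filtration_mono by blast

lemma bounded_past_times_integrable:
  assumes "0 \<le> a" "bounded_past a Z" "integrable M X"
  shows "integrable M (\<lambda>\<omega>. Z \<omega> * X \<omega>)"
proof -
  obtain C where C: "\<And>\<omega>. \<omega> \<in> space M \<Longrightarrow> \<bar>Z \<omega>\<bar> \<le> C"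
    using assms unfolding bounded_past_def by blast
  have [measurable]: "Z \<in> borel_measurable M"
    using assms measurable_filtrationD unfolding bounded_past_def by blast
  show ?thesis
  proof (rule Bochner_Integration.integrable_bound[of M "\<lambda>\<omega>. C * \<bar>X \<omega>\<bar>"])
    show "AE \<omega> in M. norm (Z \<omega> * X \<omega>) \<le> norm (C * \<bar>X \<omega>\<bar>)"
    proof (rule AE_I2)
      fix \<omega> assume "\<omega> \<in> space M"
      then have "\<bar>Z \<omega>\<bar> * \<bar>X \<omega>\<bar> \<le> \<bar>C\<bar> * \<bar>X \<omega>\<bar>"
        by (intro mult_right_mono order_trans[OF C abs_ge_self] abs_ge_zero)
      then show "norm (Z \<omega> * X \<omega>) \<le> norm (C * \<bar>X \<omega>\<bar>)"
        by (simp add: abs_mult)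
    qed
  qed (use assms in auto)
qed

lemma bounded_past_integrable: "0 \<le> a \<Longrightarrow> bounded_past a Z \<Longrightarrow> integrable M Z"
  using bounded_past_times_integrable[of a Z "\<lambda>_. 1"] by simp

text \<open>Since \<open>b \<le> c\<close>, the product of \<open>Y\<close> with the earlier
  increment is itself known at time \<open>c\<close> and serves as the past factor.\<close>

lemma past_increment_product:
  assumes ab: "0 \<le> a" "a \<le> b" "b \<le> c" "c \<le> d" and Y: "bounded_past c Y"
  shows "has_bochner_integral M (\<lambda>\<omega>. (Y \<omega> * (W b \<omega> - W a \<omega>)) * (W d \<omega> - W c \<omega>)) 0"
proof (rule past_times_increment)
  show "integrable M (\<lambda>\<omega>. Y \<omega> * (W b \<omega> - W a \<omega>))"
    using bounded_past_times_integrable[of c Y "\<lambda>\<omega>. W b \<omega> - W a \<omega>"] increment_integral[of a b] assms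
    by (auto simp: has_bochner_integral_iff)
  have "W a \<in> borel_measurable (F c)" "W b \<in> borel_measurable (F c)"
    using ab measurable_filtration_mono[of a c "W a"] measurable_filtration_mono[of b c "W b"]
      brownian_measurable by auto
  then show "(\<lambda>\<omega>. Y \<omega> * (W b \<omega> - W a \<omega>)) \<in> borel_measurable (F c)"
    using Y by (auto simp: bounded_past_def)
qed (use ab in auto)

text \<open>Cutting the longer increment at \<open>b\<close> leaves the square of the shorter one,
  of mean \<open>b - a\<close> and independent of \<open>Y\<close>, plus a product over disjoint
  intervals, of mean zero.\<close>

lemma nested_increment_product:
  assumes ab: "0 \<le> a" "a \<le> b" "b \<le> c" and Y: "bounded_past a Y"
  shows "has_bochner_integral M (\<lambda>\<omega>. Y \<omega> * (W b \<omega> - W a \<omega>) * (W c \<omega> - W a \<omega>))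
    (expectation Y * (b - a))"
proof -
  have Yb: "bounded_past b Y" and Ya: "Y \<in> borel_measurable (F a)"
    using bounded_past_mono[OF ab(1,2) Y] Y by (simp_all add: bounded_past_def)
  have "has_bochner_integral M (\<lambda>\<omega>. Y \<omega> * (W b \<omega> - W a \<omega>)\<^sup>2 +
      (Y \<omega> * (W b \<omega> - W a \<omega>)) * (W c \<omega> - W b \<omega>)) (expectation Y * (b - a) + 0)"
    by (rule has_bochner_integral_add[OF
          past_times_increment_square[OF ab(1,2) Ya bounded_past_integrable[OF ab(1) Y]]
          past_increment_product[OF ab(1,2) order_refl ab(3) Yb]])
  moreover have "Y \<omega> * (W b \<omega> - W a \<omega>)\<^sup>2 + (Y \<omega> * (W b \<omega> - W a \<omega>)) * (W c \<omega> - W b \<omega>)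
      = Y \<omega> * (W b \<omega> - W a \<omega>) * (W c \<omega> - W a \<omega>)" for \<omega>
    by (simp add: power2_eq_square algebra_simps)
  ultimately show ?thesis
    by simp
qed

text \<open>The \<open>max\<close> factor is the length of the overlap of the two intervals. The
  increment over \<open>{a<..b}\<close> is cut at \<open>a'\<close>; the piece before
  \<open>a'\<close> contributes nothing, and the rest shares its left end point with the other
  interval.\<close>

lemma elementary_increment_product:
  assumes "0 \<le> a" "a \<le> b" "a \<le> a'" "a' \<le> b'" and Z: "bounded_past a Z" and Z': "bounded_past a' Z'"
  shows "has_bochner_integral M (\<lambda>\<omega>. (Z \<omega> * (W b \<omega> - W a \<omega>)) * (Z' \<omega> * (W b' \<omega> - W a' \<omega>)))
    (expectation (\<lambda>\<omega>. Z \<omega> * Z' \<omega>) * max 0 (min b b' - max a a'))"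
proof -
  let ?Y = "\<lambda>\<omega>. Z \<omega> * Z' \<omega>"
  have Y: "bounded_past a' ?Y"
    using bounded_past_mult[OF bounded_past_mono[OF _ _ Z] Z'] assms by simp
  show ?thesis
  proof (cases "b \<le> a'")
    case True
    then show ?thesis
      using past_increment_product[of a b a' b' ?Y] assms Y by (simp add: mult_ac max_absorb1)
  next
    case False
    have "has_bochner_integral M (\<lambda>\<omega>. ?Y \<omega> * (W b \<omega> - W a' \<omega>) * (W b' \<omega> - W a' \<omega>))
        (expectation ?Y * (min b b' - a'))"
    proof (cases "b \<le> b'")
      case True
      then show ?thesis using nested_increment_product[of a' b b' ?Y] False assms Y by simp
    next
      case False
      then show ?thesis
        using nested_increment_product[of a' b' b ?Y] \<open>\<not> b \<le> a'\<close> assms Y by (simp add: mult_ac)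
    qed
    from has_bochner_integral_add[OF past_increment_product[of a a' a' b' ?Y] this]
    have "has_bochner_integral M (\<lambda>\<omega>. ?Y \<omega> * (W a' \<omega> - W a \<omega>) * (W b' \<omega> - W a' \<omega>) +
        ?Y \<omega> * (W b \<omega> - W a' \<omega>) * (W b' \<omega> - W a' \<omega>)) (expectation ?Y * (min b b' - a'))"
      using assms Y by simp
    moreover have "max 0 (min b b' - max a a') = min b b' - a'"
      using False assms by (auto simp: max_def min_def)
    moreover have "?Y \<omega> * (W a' \<omega> - W a \<omega>) * (W b' \<omega> - W a' \<omega>) +
        ?Y \<omega> * (W b \<omega> - W a' \<omega>) * (W b' \<omega> - W a' \<omega>)
        = (Z \<omega> * (W b \<omega> - W a \<omega>)) * (Z' \<omega> * (W b' \<omega> - W a' \<omega>))" for \<omega>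
      by (simp add: algebra_simps)
    ultimately show ?thesis
      by simp
  qed
qed

lemma elementary_integral_product:
  assumes "0 \<le> a" "a \<le> b" "0 \<le> a'" "a' \<le> b'" "bounded_past a Z" "bounded_past a' Z'"
  shows "has_bochner_integral M
    (\<lambda>\<omega>. (Z \<omega> * (W (min b t) \<omega> - W (min a t) \<omega>)) * (Z' \<omega> * (W (min b' t) \<omega> - W (min a' t) \<omega>)))
    (expectation (\<lambda>\<omega>. Z \<omega> * Z' \<omega>) * max 0 (min (min b b') t - max a a'))"
proof (cases "a \<le> t \<and> a' \<le> t")
  case True
  have *: "has_bochner_integral M
    (\<lambda>\<omega>. (Z \<omega> * (W (min b t) \<omega> - W a \<omega>)) * (Z' \<omega> * (W (min b' t) \<omega> - W a' \<omega>)))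
    (expectation (\<lambda>\<omega>. Z \<omega> * Z' \<omega>) * max 0 (min (min b t) (min b' t) - max a a'))"
  proof (cases "a \<le> a'")
    case le: True
    then show ?thesis
      using elementary_increment_product[of a "min b t" a' "min b' t" Z Z'] assms True by auto
  next
    case False
    have "has_bochner_integral M
      (\<lambda>\<omega>. (Z' \<omega> * (W (min b' t) \<omega> - W a' \<omega>)) * (Z \<omega> * (W (min b t) \<omega> - W a \<omega>)))
      (expectation (\<lambda>\<omega>. Z' \<omega> * Z \<omega>) * max 0 (min (min b' t) (min b t) - max a' a))"
      using elementary_increment_product[of a' "min b' t" a "min b t" Z' Z] assms True False by auto
    from has_bochner_integral_swap_factors[OF this]
    show ?thesis
      by (simp add: min.commute[of "min b' t"] max.commute[of a'] mult.commute[of "Z' _"])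
  qed
  have "min (min b t) (min b' t) = min (min b b') t"
    by (simp add: min_def)
  with * True show ?thesis
    by (simp add: min_absorb1)
next
  case False
  \<comment> \<open>An interval that starts after \<open>t\<close> is collapsed to a point by
    \<open>min\<close>, so its increment vanishes together with the overlap.\<close>
  then have "max 0 (min (min b b') t - max a a') = 0"
    by (auto simp: max_def min_def)
  moreover have "(Z \<omega> * (W (min b t) \<omega> - W (min a t) \<omega>)) * (Z' \<omega> * (W (min b' t) \<omega> - W (min a' t) \<omega>)) = 0" for \<omega>
    using False assms by (auto simp: min_def)
  ultimately show ?thesis
    by (simp only: has_bochner_integral_zero mult_zero_right)
qed

text \<open>Both sides equal the quadratic form with entries
  \<open>expectation (\<lambda>\<omega>. Z i \<omega> * Z j \<omega>)\<close> times the overlap of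
  the intervals \<open>i\<close> and \<open>j\<close> up to time \<open>t\<close>. The intervals may
  overlap and the index type is free, so that two processes on unrelated grids can be merged without
  a common refinement.\<close>

lemma elementary_process_isometry:
  fixes Z :: "'i \<Rightarrow> 'a \<Rightarrow> real"
  assumes "finite J" "\<And>i. i \<in> J \<Longrightarrow> 0 \<le> a i" "\<And>i. i \<in> J \<Longrightarrow> a i \<le> b i"
    and Z: "\<And>i. i \<in> J \<Longrightarrow> bounded_past (a i) (Z i)"
  shows "(\<integral>\<^sup>+\<omega>. ennreal ((\<Sum>i\<in>J. Z i \<omega> * (W (min (b i) t) \<omega> - W (min (a i) t) \<omega>))\<^sup>2) \<partial>M)
    = (\<integral>\<^sup>+\<omega>. (\<integral>\<^sup>+s\<in>{0..t}. ennreal ((\<Sum>i\<in>J. Z i \<omega> * indicator {a i<..b i} s)\<^sup>2) \<partial>lborel) \<partial>M)"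
proof -
  define q where "q i j = max 0 (min (min (b i) (b j)) t - max (a i) (a j))" for i j
  have "has_bochner_integral M
      (\<lambda>\<omega>. \<Sum>i\<in>J. \<Sum>j\<in>J. (Z i \<omega> * (W (min (b i) t) \<omega> - W (min (a i) t) \<omega>)) *
        (Z j \<omega> * (W (min (b j) t) \<omega> - W (min (a j) t) \<omega>)))
      (\<Sum>i\<in>J. \<Sum>j\<in>J. expectation (\<lambda>\<omega>. Z i \<omega> * Z j \<omega>) * q i j)"
    unfolding q_def using assms
    by (intro has_bochner_integral_sum elementary_integral_product) auto
  then have 1: "has_bochner_integral M
      (\<lambda>\<omega>. (\<Sum>i\<in>J. Z i \<omega> * (W (min (b i) t) \<omega> - W (min (a i) t) \<omega>))\<^sup>2)
      (\<Sum>i\<in>J. \<Sum>j\<in>J. expectation (\<lambda>\<omega>. Z i \<omega> * Z j \<omega>) * q i j)"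
    by (simp add: power2_eq_square sum_product)
  have "has_bochner_integral M (\<lambda>\<omega>. Z i \<omega> * Z j \<omega> * q i j) (expectation (\<lambda>\<omega>. Z i \<omega> * Z j \<omega>) * q i j)"
    if "i \<in> J" "j \<in> J" for i j
    using bounded_past_times_integrable[OF _ Z[OF that(1)] bounded_past_integrable[OF _ Z[OF that(2)]]]
      that assms by (intro has_bochner_integral_mult_left) (auto simp: has_bochner_integral_iff)
  then have 2: "has_bochner_integral M
      (\<lambda>\<omega>. \<Sum>i\<in>J. \<Sum>j\<in>J. Z i \<omega> * Z j \<omega> * q i j)
      (\<Sum>i\<in>J. \<Sum>j\<in>J. expectation (\<lambda>\<omega>. Z i \<omega> * Z j \<omega>) * q i j)"
    by (intro has_bochner_integral_sum)
  have 3: "has_bochner_integral lborel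
      (\<lambda>s. (\<Sum>i\<in>J. Z i \<omega> * indicator {a i<..b i} s)\<^sup>2 * indicator {0..t} s)
      (\<Sum>i\<in>J. \<Sum>j\<in>J. Z i \<omega> * Z j \<omega> * q i j)" for \<omega>
  proof -
    have *: "has_bochner_integral lborel
        (\<lambda>s. indicator {max (a i) (a j)<..min (min (b i) (b j)) t} s) (q i j)" for i j
    proof -
      have "measure lborel {max (a i) (a j)<..min (min (b i) (b j)) t} = q i j"
        by (cases "max (a i) (a j) \<le> min (min (b i) (b j)) t") (auto simp: q_def measure_def)
      moreover have "emeasure lborel {max (a i) (a j)<..min (min (b i) (b j)) t} < \<infinity>"
        by (rule le_less_trans[OF emeasure_mono[of _ "{max (a i) (a j)..min (min (b i) (b j)) t}"]])
           (auto simp: emeasure_lborel_Icc_eq)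
      ultimately show ?thesis
        using has_bochner_integral_real_indicator[of "{max (a i) (a j)<..min (min (b i) (b j)) t}" lborel]
        by simp
    qed
    have "has_bochner_integral lborel
        (\<lambda>s. \<Sum>i\<in>J. \<Sum>j\<in>J. Z i \<omega> * Z j \<omega> * indicator {max (a i) (a j)<..min (min (b i) (b j)) t} s)
        (\<Sum>i\<in>J. \<Sum>j\<in>J. Z i \<omega> * Z j \<omega> * q i j)"
      by (intro has_bochner_integral_sum has_bochner_integral_mult_right *)
    moreover have "(\<Sum>i\<in>J. \<Sum>j\<in>J. Z i \<omega> * Z j \<omega> * indicator {max (a i) (a j)<..min (min (b i) (b j)) t} s)
       = (\<Sum>i\<in>J. Z i \<omega> * indicator {a i<..b i} s)\<^sup>2 * indicator {0..t} s" for s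
    proof -
      have "Z i \<omega> * Z j \<omega> * indicator {max (a i) (a j)<..min (min (b i) (b j)) t} s
          = (Z i \<omega> * indicator {a i<..b i} s) * (Z j \<omega> * indicator {a j<..b j} s) * indicator {0..t} s"
        if "i \<in> J" for i j
        using assms(2)[OF that] by (auto split: split_indicator)
      then have "(\<Sum>i\<in>J. \<Sum>j\<in>J. Z i \<omega> * Z j \<omega> * indicator {max (a i) (a j)<..min (min (b i) (b j)) t} s)
        = (\<Sum>i\<in>J. \<Sum>j\<in>J. (Z i \<omega> * indicator {a i<..b i} s) * (Z j \<omega> * indicator {a j<..b j} s) * indicator {0..t} s)"
        by (intro sum.cong) auto
      also have "\<dots> = (\<Sum>i\<in>J. Z i \<omega> * indicator {a i<..b i} s)\<^sup>2 * indicator {0..t} s"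
        by (simp only: power2_eq_square sum_product) (simp add: sum_distrib_right)
      finally show ?thesis .
    qed
    ultimately show ?thesis
      by simp
  qed
  have 4: "(\<integral>\<^sup>+s\<in>{0..t}. ennreal ((\<Sum>i\<in>J. Z i \<omega> * indicator {a i<..b i} s)\<^sup>2) \<partial>lborel)
      = ennreal (\<Sum>i\<in>J. \<Sum>j\<in>J. Z i \<omega> * Z j \<omega> * q i j)" for \<omega>
  proof -
    have "(\<integral>\<^sup>+s\<in>{0..t}. ennreal ((\<Sum>i\<in>J. Z i \<omega> * indicator {a i<..b i} s)\<^sup>2) \<partial>lborel)
      = (\<integral>\<^sup>+s. ennreal ((\<Sum>i\<in>J. Z i \<omega> * indicator {a i<..b i} s)\<^sup>2 * indicator {0..t} s) \<partial>lborel)"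
      by (intro nn_integral_cong) (auto split: split_indicator)
    also have "\<dots> = ennreal (\<Sum>i\<in>J. \<Sum>j\<in>J. Z i \<omega> * Z j \<omega> * q i j)"
      using 3[of \<omega>] by (subst nn_integral_eq_integral) (auto simp: has_bochner_integral_iff)
    finally show ?thesis .
  qed
  \<comment> \<open>For each outcome this form is the time integral of a square. Its sign is needed
    to read its expectation as an extended nonnegative integral.\<close>
  have 5: "0 \<le> (\<Sum>i\<in>J. \<Sum>j\<in>J. Z i \<omega> * Z j \<omega> * q i j)" for \<omega>
    by (subst has_bochner_integral_integral_eq[OF 3, symmetric]) (rule integral_nonneg_AE, simp)
  have "(\<integral>\<^sup>+\<omega>. ennreal ((\<Sum>i\<in>J. Z i \<omega> * (W (min (b i) t) \<omega> - W (min (a i) t) \<omega>))\<^sup>2) \<partial>M)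
      = ennreal (\<Sum>i\<in>J. \<Sum>j\<in>J. expectation (\<lambda>\<omega>. Z i \<omega> * Z j \<omega>) * q i j)"
    using 1 by (subst nn_integral_eq_integral) (auto simp: has_bochner_integral_iff)
  also have "\<dots> = (\<integral>\<^sup>+\<omega>. ennreal (\<Sum>i\<in>J. \<Sum>j\<in>J. Z i \<omega> * Z j \<omega> * q i j) \<partial>M)"
    using 2 5 by (subst nn_integral_eq_integral) (auto simp: has_bochner_integral_iff)
  finally show ?thesis
    by (simp add: 4)
qed

end

section \<open>Differences of Ito integrals\<close>

lemma square_sum3_le: "((x::real) + y + z)\<^sup>2 \<le> 3 * (x\<^sup>2 + y\<^sup>2 + z\<^sup>2)"
proof -
  have "0 \<le> (x - y)\<^sup>2 + (y - z)\<^sup>2 + (x - z)\<^sup>2"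
    by simp
  then show ?thesis
    by (simp add: power2_eq_square algebra_simps)
qed

lemma nn_integral_square_diff3:
  fixes f g f' g' :: "'b \<Rightarrow> real"
  assumes [measurable]: "f \<in> borel_measurable N" "g \<in> borel_measurable N"
      "f' \<in> borel_measurable N" "g' \<in> borel_measurable N"
  shows "(\<integral>\<^sup>+x. ennreal ((f x - g x)\<^sup>2) \<partial>N) \<le> 3 * ((\<integral>\<^sup>+x. ennreal ((f' x - f x)\<^sup>2) \<partial>N) +
    (\<integral>\<^sup>+x. ennreal ((f' x - g' x)\<^sup>2) \<partial>N) + (\<integral>\<^sup>+x. ennreal ((g' x - g x)\<^sup>2) \<partial>N))"
proof -
  have "ennreal ((f x - g x)\<^sup>2) \<le>
      3 * (ennreal ((f' x - f x)\<^sup>2) + ennreal ((f' x - g' x)\<^sup>2) + ennreal ((g' x - g x)\<^sup>2))" for x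
  proof -
    have "(f x - g x)\<^sup>2 \<le> 3 * ((f' x - f x)\<^sup>2 + (f' x - g' x)\<^sup>2 + (g' x - g x)\<^sup>2)"
      using square_sum3_le[of "f x - f' x" "f' x - g' x" "g' x - g x"]
      by (simp add: power2_commute[of "f x" "f' x"])
    then have "ennreal ((f x - g x)\<^sup>2) \<le> ennreal (3 * ((f' x - f x)\<^sup>2 + (f' x - g' x)\<^sup>2 + (g' x - g x)\<^sup>2))"
      by (rule ennreal_leI)
    then show ?thesis
      by (simp add: ennreal_mult ennreal_plus)
  qed
  then have "(\<integral>\<^sup>+x. ennreal ((f x - g x)\<^sup>2) \<partial>N) \<le>
      (\<integral>\<^sup>+x. 3 * (ennreal ((f' x - f x)\<^sup>2) + ennreal ((f' x - g' x)\<^sup>2) + ennreal ((g' x - g x)\<^sup>2)) \<partial>N)"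
    by (rule nn_integral_mono)
  then show ?thesis
    by (simp add: nn_integral_cmult nn_integral_add)
qed

section \<open>Fubini on time and outcomes, and passage from simple processes to general
  integrands\<close>

context brownian_filtration
begin

definition time_product :: "real \<Rightarrow> (real \<times> 'a) measure" where
  "time_product t = restrict_space lborel {0..t} \<Otimes>\<^sub>M M"

lemma sigma_finite_restrict_lborel: "sigma_finite_measure (restrict_space lborel {0..t::real})"
  by (rule finite_measure.sigma_finite_measure, rule finite_measureI)
     (simp add: emeasure_restrict_space space_restrict_space emeasure_lborel_Icc_eq)

text \<open>The first order of integration is that of \<open>is_ito_integral\<close>; the second
  fixes the time and averages over outcomes, which is the form in which moment bounds are
  available.\<close>

lemma nn_integral_time_product:
  assumes "(\<lambda>(s, \<omega>). f s \<omega>) \<in> borel_measurable (time_product t)"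
  shows "(\<integral>\<^sup>+(s, \<omega>). f s \<omega> \<partial>time_product t) = (\<integral>\<^sup>+\<omega>. (\<integral>\<^sup>+s\<in>{0..t}. f s \<omega> \<partial>lborel) \<partial>M)"
    and "(\<integral>\<^sup>+(s, \<omega>). f s \<omega> \<partial>time_product t) = (\<integral>\<^sup>+s\<in>{0..t}. (\<integral>\<^sup>+\<omega>. f s \<omega> \<partial>M) \<partial>lborel)"
proof -
  interpret R: sigma_finite_measure "restrict_space lborel {0..t}"
    by (rule sigma_finite_restrict_lborel)
  interpret P: pair_sigma_finite "restrict_space lborel {0..t}" M ..
  have m: "case_prod f \<in> borel_measurable (restrict_space lborel {0..t} \<Otimes>\<^sub>M M)"
    using assms by (simp add: time_product_def)
  show "(\<integral>\<^sup>+(s, \<omega>). f s \<omega> \<partial>time_product t) = (\<integral>\<^sup>+\<omega>. (\<integral>\<^sup>+s\<in>{0..t}. f s \<omega> \<partial>lborel) \<partial>M)"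
    using P.nn_integral_snd[OF m] by (simp add: time_product_def nn_integral_restrict_space)
  show "(\<integral>\<^sup>+(s, \<omega>). f s \<omega> \<partial>time_product t) = (\<integral>\<^sup>+s\<in>{0..t}. (\<integral>\<^sup>+\<omega>. f s \<omega> \<partial>M) \<partial>lborel)"
    using nn_integral_fst[OF m] by (simp add: time_product_def nn_integral_restrict_space)
qed

text \<open>Progressive measurability refers to \<open>F t\<close>, the product measure to
  \<open>M\<close>; the first product sigma-algebra is contained in the second.\<close>

lemma progressively_measurable_time_product:
  assumes "progressively_measurable F N H" "0 \<le> t"
  shows "(\<lambda>(s, \<omega>). H s \<omega>) \<in> measurable (time_product t) N"
proof -
  have "(\<lambda>(s, \<omega>). H s \<omega>) \<in> measurable (restrict_space borel {0..t} \<Otimes>\<^sub>M F t) N"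
    using assms by (simp add: progressively_measurable_def)
  moreover have "subalgebra (time_product t) (restrict_space borel {0..t} \<Otimes>\<^sub>M F t)"
    unfolding subalgebra_def
  proof
    show "space (restrict_space borel {0..t} \<Otimes>\<^sub>M F t) = space (time_product t)"
      using space_filtration assms(2) by (simp add: space_pair_measure time_product_def space_restrict_space)
    show "sets (restrict_space borel {0..t} \<Otimes>\<^sub>M F t) \<subseteq> sets (time_product t)"
    proof (rule sets_pair_in_sets)
      show "A \<times> B \<in> sets (time_product t)"
        if "A \<in> sets (restrict_space borel {0..t})" "B \<in> sets (F t)" for A B
        unfolding time_product_def
      proof (rule pair_measureI)
        show "A \<in> sets (restrict_space lborel {0..t})"
          using that(1) by (simp add: sets_restrict_space)
        show "B \<in> sets M"
          using that(2) subalgebra_filtration[OF assms(2)] by (auto simp: subalgebra_def)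
      qed
    qed
  qed
  ultimately show ?thesis
    by (rule measurable_from_subalg[rotated])
qed

lemma simple_integrandD:
  assumes "simple_integrand F (n, \<tau>, Z)" "i < n"
  shows "0 \<le> \<tau> i" "\<tau> i \<le> \<tau> (Suc i)" "bounded_past (\<tau> i) (Z i)"
proof -
  have step: "\<tau> j \<le> \<tau> (Suc j)" if "j < n" for j
    using assms(1) that by (simp add: simple_integrand_def)
  have "j \<le> n \<Longrightarrow> 0 \<le> \<tau> j" for j
  proof (induction j)
    case 0
    then show ?case using assms(1) by (simp add: simple_integrand_def)
  next
    case (Suc j)
    then show ?case using step[of j] by simp
  qed
  then show *: "0 \<le> \<tau> i"
    using assms(2) by simp
  show "\<tau> i \<le> \<tau> (Suc i)"
    using assms by (simp add: simple_integrand_def)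
  show "bounded_past (\<tau> i) (Z i)"
    using assms by (simp add: simple_integrand_def bounded_past_def flip: space_filtration[OF *])
qed

lemma simple_process_time_product:
  assumes "simple_integrand F S"
  shows "(\<lambda>(s, \<omega>). simple_process S s \<omega>) \<in> borel_measurable (time_product t)"
proof -
  obtain n \<tau> Z where S: "S = (n, \<tau>, Z)"
    by (cases S)
  have [measurable]: "Z i \<in> borel_measurable M" if "i < n" for i
    using simple_integrandD[OF assms[unfolded S] that]
    by (intro measurable_filtrationD[of "\<tau> i" "Z i"]) (simp_all add: bounded_past_def)
  have [measurable]: "(\<lambda>s. s) \<in> borel_measurable (restrict_space lborel {0..t})"
    by (simp add: measurable_restrict_space1)
  show ?thesis
    unfolding S simple_process_def prod.case time_product_def by measurable
qed

lemma simple_integral_measurable: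
  assumes "simple_integrand F S" "0 \<le> t"
  shows "simple_integral W S t \<in> borel_measurable M"
proof -
  obtain n \<tau> Z where S: "S = (n, \<tau>, Z)"
    by (cases S)
  note D = simple_integrandD[OF assms(1)[unfolded S]]
  have [measurable]: "Z i \<in> borel_measurable M" if "i < n" for i
    using D[OF that] by (intro measurable_filtrationD[of "\<tau> i" "Z i"]) (simp_all add: bounded_past_def)
  have W: "W s \<in> borel_measurable M" if "0 \<le> s" for s
    using brownian_measurable measurable_filtrationD that by blast
  have [measurable]: "W (min (\<tau> i) t) \<in> borel_measurable M"
      "W (min (\<tau> (Suc i)) t) \<in> borel_measurable M" if "i < n" for i
    using D[OF that] assms(2) by (auto intro!: W)
  show ?thesis
    unfolding S simple_integral_def prod.case by measurable
qed

text \<open>The difference is one elementary process over the disjoint sum of the two index sets,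
  with the second family of coefficients negated.\<close>

lemma simple_integral_diff_isometry:
  assumes "simple_integrand F S" "simple_integrand F S'"
  shows "(\<integral>\<^sup>+\<omega>. ennreal ((simple_integral W S t \<omega> - simple_integral W S' t \<omega>)\<^sup>2) \<partial>M)
    = (\<integral>\<^sup>+\<omega>. (\<integral>\<^sup>+s\<in>{0..t}. ennreal ((simple_process S s \<omega> - simple_process S' s \<omega>)\<^sup>2) \<partial>lborel) \<partial>M)"
proof -
  obtain n \<tau> Z n' \<tau>' Z' where S: "S = (n, \<tau>, Z)" "S' = (n', \<tau>', Z')"
    by (cases S, cases S')
  note D = simple_integrandD[OF assms(1)[unfolded S]] and D' = simple_integrandD[OF assms(2)[unfolded S]]
  let ?J = "{..<n} <+> {..<n'}"
  let ?Z = "case_sum Z (\<lambda>i \<omega>. - Z' i \<omega>)"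
  let ?a = "case_sum \<tau> \<tau>'" and ?b = "case_sum (\<lambda>i. \<tau> (Suc i)) (\<lambda>i. \<tau>' (Suc i))"
  have neg: "bounded_past a (\<lambda>\<omega>. - Y \<omega>)" if "bounded_past a Y" for a Y
    using that by (simp add: bounded_past_def)
  have "(\<integral>\<^sup>+\<omega>. ennreal ((\<Sum>i\<in>?J. ?Z i \<omega> * (W (min (?b i) t) \<omega> - W (min (?a i) t) \<omega>))\<^sup>2) \<partial>M)
    = (\<integral>\<^sup>+\<omega>. (\<integral>\<^sup>+s\<in>{0..t}. ennreal ((\<Sum>i\<in>?J. ?Z i \<omega> * indicator {?a i<..?b i} s)\<^sup>2) \<partial>lborel) \<partial>M)"
    by (rule elementary_process_isometry) (auto simp: D D' intro!: neg)
  then show ?thesis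
    by (simp add: S simple_integral_def simple_process_def sum.Plus sum_negf
        del: Bochner_Integration.sum_mult_indicator Bochner_Integration.sum_indicator_mult)
qed

text \<open>Linearity of the integral is avoided: the two integrals are approximated separately, the
  exact isometry is applied to the difference of the simple approximations, and the limit is taken.
  The true constant is 1; two squared triangle inequalities make it \<open>3 * 3\<close>.\<close>

theorem ito_integral_diff_le:
  assumes I: "is_ito_integral M F W H I" and I': "is_ito_integral M F W H' I'" and t: "0 \<le> t"
  shows "(\<integral>\<^sup>+\<omega>. ennreal ((I t \<omega> - I' t \<omega>)\<^sup>2) \<partial>M)
    \<le> 9 * (\<integral>\<^sup>+s\<in>{0..t}. (\<integral>\<^sup>+\<omega>. ennreal ((H s \<omega> - H' s \<omega>)\<^sup>2) \<partial>M) \<partial>lborel)"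
proof -
  define N where "N G G' = (\<integral>\<^sup>+\<omega>. (\<integral>\<^sup>+s\<in>{0..t}. ennreal ((G s \<omega> - G' s \<omega>)\<^sup>2) \<partial>lborel) \<partial>M)"
    for G G' :: "real \<Rightarrow> 'a \<Rightarrow> real"
  define L where "L X Y = (\<integral>\<^sup>+\<omega>. ennreal ((X \<omega> - Y \<omega>)\<^sup>2) \<partial>M)" for X Y :: "'a \<Rightarrow> real"
  obtain S S' where S: "\<And>n. simple_integrand F (S n)" "\<And>n. simple_integrand F (S' n)"
    and lim: "(\<lambda>n. N (simple_process (S n)) H) \<longlonglongrightarrow> 0" "(\<lambda>n. N (simple_process (S' n)) H') \<longlonglongrightarrow> 0"
      "(\<lambda>n. L (simple_integral W (S n) t) (I t)) \<longlonglongrightarrow> 0"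
      "(\<lambda>n. L (simple_integral W (S' n) t) (I' t)) \<longlonglongrightarrow> 0"
  proof -
    from I t obtain S where "\<forall>n. simple_integrand F (S n)"
        "(\<lambda>n. N (simple_process (S n)) H) \<longlonglongrightarrow> 0" "(\<lambda>n. L (simple_integral W (S n) t) (I t)) \<longlonglongrightarrow> 0"
      unfolding is_ito_integral_def N_def L_def by blast
    moreover from I' t obtain S' where "\<forall>n. simple_integrand F (S' n)"
        "(\<lambda>n. N (simple_process (S' n)) H') \<longlonglongrightarrow> 0" "(\<lambda>n. L (simple_integral W (S' n) t) (I' t)) \<longlonglongrightarrow> 0"
      unfolding is_ito_integral_def N_def L_def by blast
    ultimately show thesis
      using that by blast
  qed
  have H: "(\<lambda>(s, \<omega>). H s \<omega>) \<in> borel_measurable (time_product t)"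
      "(\<lambda>(s, \<omega>). H' s \<omega>) \<in> borel_measurable (time_product t)"
    using I I' progressively_measurable_time_product[OF _ t] by (auto simp: is_ito_integral_def)
  have It: "I t \<in> borel_measurable M" "I' t \<in> borel_measurable M"
    using I I' t
    by (auto simp: is_ito_integral_def adapted_to_def intro: measurable_filtrationD[OF t])
  have sq: "(\<lambda>(s, \<omega>). ennreal ((G s \<omega> - G' s \<omega>)\<^sup>2)) \<in> borel_measurable (time_product t)"
    if [measurable]: "(\<lambda>(s, \<omega>). G s \<omega>) \<in> borel_measurable (time_product t)"
      "(\<lambda>(s, \<omega>). G' s \<omega>) \<in> borel_measurable (time_product t)"
    for G G' :: "real \<Rightarrow> 'a \<Rightarrow> real"
    using borel_measurable_diff[OF that] by (simp add: case_prod_beta')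
  have N: "N G G' = (\<integral>\<^sup>+z. ennreal (((\<lambda>(s, \<omega>). G s \<omega>) z - (\<lambda>(s, \<omega>). G' s \<omega>) z)\<^sup>2) \<partial>time_product t)"
    if "(\<lambda>(s, \<omega>). G s \<omega>) \<in> borel_measurable (time_product t)"
      "(\<lambda>(s, \<omega>). G' s \<omega>) \<in> borel_measurable (time_product t)" for G G'
    using nn_integral_time_product(1)[OF sq[OF that]] by (simp add: N_def case_prod_beta')
  \<comment> \<open>The outer 3 pays for passing from \<open>I\<close> and \<open>I'\<close> to
    simple integrals, the inner 3 for passing back from the simple processes to \<open>H\<close> and
    \<open>H'\<close>.\<close>
  let ?b = "\<lambda>n. 3 * (L (simple_integral W (S n) t) (I t) +
      3 * (N (simple_process (S n)) H + N H H' + N (simple_process (S' n)) H') +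
      L (simple_integral W (S' n) t) (I' t))"
  have "L (I t) (I' t) \<le> ?b n" for n
  proof -
    let ?X = "simple_integral W (S n) t" and ?X' = "simple_integral W (S' n) t"
    note P = simple_process_time_product[OF S(1)[of n], of t] simple_process_time_product[OF S(2)[of n], of t]
    have le: "L (I t) (I' t) \<le> 3 * (L ?X (I t) + L ?X ?X' + L ?X' (I' t))"
      unfolding L_def
      by (intro nn_integral_square_diff3 It simple_integral_measurable S t)
    have "L ?X ?X' = N (simple_process (S n)) (simple_process (S' n))"
      unfolding L_def N_def by (rule simple_integral_diff_isometry[OF S])
    moreover have "N (simple_process (S n)) (simple_process (S' n)) \<le>
        3 * (N H (simple_process (S n)) + N H H' + N H' (simple_process (S' n)))"
      unfolding N[OF P] N[OF H] N[OF H(1) P(1)] N[OF H(2) P(2)]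
      by (rule nn_integral_square_diff3[OF P H])
    moreover have "N H (simple_process (S n)) = N (simple_process (S n)) H"
        "N H' (simple_process (S' n)) = N (simple_process (S' n)) H'"
      unfolding N_def
      by (intro nn_integral_cong arg_cong2[where f = "(*)"] arg_cong[where f = ennreal] power2_commute refl)+
    ultimately have "L ?X ?X' \<le> 3 * (N (simple_process (S n)) H + N H H' + N (simple_process (S' n)) H')"
      by simp
    then have "3 * (L ?X (I t) + L ?X ?X' + L ?X' (I' t)) \<le> ?b n"
      by (intro mult_left_mono add_mono order_refl) auto
    with le show ?thesis
      by (rule order_trans)
  qed
  moreover have "?b \<longlonglongrightarrow> 3 * (0 + 3 * (0 + N H H' + 0) + 0)"
    by (intro ennreal_tendsto_cmult tendsto_add tendsto_const lim) auto
  ultimately have "L (I t) (I' t) \<le> 3 * (0 + 3 * (0 + N H H' + 0) + 0)"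
    by (intro LIMSEQ_le_const) auto
  also have "\<dots> = 9 * N H H'"
    by (simp add: mult.assoc[symmetric])
  also have "N H H' = (\<integral>\<^sup>+s\<in>{0..t}. (\<integral>\<^sup>+\<omega>. ennreal ((H s \<omega> - H' s \<omega>)\<^sup>2) \<partial>M) \<partial>lborel)"
    unfolding N_def using nn_integral_time_product[OF sq[OF H]] by simp
  finally show ?thesis
    by (simp add: L_def)
qed

end

section \<open>Scaled moments and their volatility\<close>

text \<open>The complement of the support is a union of open null sets, and the Lindelof property
  leaves countably many of them. This turns inclusion of supports into an almost sure bound on
  \<open>x\<close>.\<close>

lemma AE_measure_support:
  assumes "sets \<nu> = sets (borel :: real measure)"
  shows "AE x in \<nu>. x \<in> measure_support \<nu>"
proof -
  let ?N = "{S. open S \<and> emeasure \<nu> S = 0}"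
  have eq: "- measure_support \<nu> = \<Union>?N"
    by (auto simp: measure_support_def)
  obtain N' where N': "N' \<subseteq> ?N" "countable N'" "\<Union>N' = \<Union>?N"
    using Lindelof[of ?N] by auto
  have "(\<Union>S\<in>N'. S) \<in> null_sets \<nu>"
    using N' assms by (intro null_sets_UN') (auto simp: null_sets_def)
  then have "- measure_support \<nu> \<in> null_sets \<nu>"
    using eq N'(3) by simp
  then show ?thesis
    by (rule AE_I') auto
qed

lemma bounded_continuous_integrable:
  assumes "f \<in> bounded_continuous" "real_distribution \<nu>"
  shows "integrable \<nu> f"
proof -
  interpret real_distribution \<nu> by fact
  obtain B where "\<And>x. \<bar>f x\<bar> \<le> B"
    using assms(1) by (auto simp: bounded_continuous_def bounded_iff)
  moreover have "f \<in> borel_measurable borel"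
    using assms(1) by (auto simp: bounded_continuous_def intro: borel_measurable_continuous_onI)
  ultimately show ?thesis
    by (intro integrable_const_bound[of _ B]) auto
qed

text \<open>The elementary half of Kantorovich duality: under any coupling the difference of the
  integrals is the integral of \<open>f (fst z) - f (snd z)\<close>, to which the Lipschitz bound
  applies.\<close>

lemma lipschitz_wasserstein1_le:
  fixes f :: "real \<Rightarrow> real"
  assumes "real_distribution \<mu>" "real_distribution \<nu>" "f \<in> bounded_continuous"
    and L: "\<And>x y. \<bar>f x - f y\<bar> \<le> L * \<bar>x - y\<bar>" and "0 < L"
  shows "ennreal \<bar>(\<integral>x. f x \<partial>\<mu>) - (\<integral>x. f x \<partial>\<nu>)\<bar> \<le> ennreal L * wasserstein1 \<mu> \<nu>"
proof -
  interpret \<mu>: real_distribution \<mu> by fact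
  interpret \<nu>: real_distribution \<nu> by fact
  have [measurable]: "f \<in> borel_measurable borel"
    using assms(3) by (auto simp: bounded_continuous_def intro: borel_measurable_continuous_onI)
  let ?x = "ennreal \<bar>(\<integral>x. f x \<partial>\<mu>) - (\<integral>x. f x \<partial>\<nu>)\<bar>"
  \<comment> \<open>Dividing by \<open>L\<close> first gives a lower bound for every coupling cost,
    so the infimum can be taken with no constant inside it.\<close>
  have inv: "ennreal (1 / L) * (ennreal L * y) = y" "ennreal L * (ennreal (1 / L) * y) = y" for y
    using \<open>0 < L\<close> by (simp_all add: mult.assoc[symmetric] ennreal_mult[symmetric])
  have "ennreal (1 / L) * ?x \<le> (\<integral>\<^sup>+ z. ennreal \<bar>fst z - snd z\<bar> \<partial>\<pi>)"
    if "\<pi> \<in> couplings \<mu> \<nu>" for \<pi>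
  proof -
    have [measurable_cong]: "sets \<pi> = sets (borel \<Otimes>\<^sub>M borel)" and d: "distr \<pi> borel fst = \<mu>" "distr \<pi> borel snd = \<nu>"
      using that by (auto simp: couplings_def)
    have i: "integrable \<pi> (\<lambda>z. f (fst z))" "integrable \<pi> (\<lambda>z. f (snd z))"
      using bounded_continuous_integrable[OF assms(3,1)] bounded_continuous_integrable[OF assms(3,2)]
      by (auto simp flip: d simp: integrable_distr_eq)
    have "(\<integral>x. f x \<partial>\<mu>) - (\<integral>x. f x \<partial>\<nu>) = (\<integral>z. f (fst z) - f (snd z) \<partial>\<pi>)"
      using i by (auto simp flip: d simp: integral_distr)
    also have "ennreal \<bar>\<dots>\<bar> \<le> (\<integral>\<^sup>+z. ennreal \<bar>f (fst z) - f (snd z)\<bar> \<partial>\<pi>)"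
      using integral_norm_bound_ennreal[OF Bochner_Integration.integrable_diff[OF i]] by simp
    also have "\<dots> \<le> (\<integral>\<^sup>+z. ennreal L * ennreal \<bar>fst z - snd z\<bar> \<partial>\<pi>)"
      using L \<open>0 < L\<close> by (intro nn_integral_mono) (auto simp flip: ennreal_mult intro!: ennreal_leI)
    also have "\<dots> = ennreal L * (\<integral>\<^sup>+z. ennreal \<bar>fst z - snd z\<bar> \<partial>\<pi>)"
      by (rule nn_integral_cmult) measurable
    finally show ?thesis
      using mult_left_mono[of ?x _ "ennreal (1 / L)"] inv(1) by (metis zero_le)
  qed
  then have "ennreal (1 / L) * ?x \<le> wasserstein1 \<mu> \<nu>"
    unfolding wasserstein1_def by (rule INF_greatest)
  from mult_left_mono[OF this, of "ennreal L"] show ?thesis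
    by (simp add: inv)
qed

text \<open>The induction sends a Lipschitz constant \<open>c\<close> to \<open>s * c + 1\<close>,
  and \<open>1 / (1 - s)\<close> is the fixed point of this map; hence one constant for all
  exponents.\<close>

lemma power_diff_le:
  fixes X Y s :: real
  assumes "\<bar>X\<bar> \<le> s" "\<bar>Y\<bar> \<le> s" "s < 1"
  shows "\<bar>X ^ n - Y ^ n\<bar> \<le> \<bar>X - Y\<bar> / (1 - s)"
proof (induction n)
  case (Suc n)
  have s: "0 \<le> s" using assms by linarith
  have "X ^ Suc n - Y ^ Suc n = X * (X ^ n - Y ^ n) + (X - Y) * Y ^ n"
    by (simp add: algebra_simps)
  also have "\<bar>\<dots>\<bar> \<le> \<bar>X\<bar> * \<bar>X ^ n - Y ^ n\<bar> + \<bar>X - Y\<bar> * \<bar>Y\<bar> ^ n"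
    using abs_triangle_ineq[of "X * (X ^ n - Y ^ n)" "(X - Y) * Y ^ n"] by (simp add: abs_mult power_abs)
  also have "\<dots> \<le> s * (\<bar>X - Y\<bar> / (1 - s)) + \<bar>X - Y\<bar> * 1"
    using assms s Suc by (intro add_mono mult_mono power_le_one) auto
  also have "\<dots> = \<bar>X - Y\<bar> / (1 - s)"
    using assms(3) by (simp add: field_simps)
  finally show ?case .
qed (use assms in auto)

lemma geometric_weight_summable:
  fixes q :: real
  assumes "0 \<le> q" "q < 1" "\<And>i. \<bar>b i\<bar> \<le> B"
  shows "summable (\<lambda>i. q ^ i * b i)"
proof (rule summable_comparison_test')
  show "summable (\<lambda>i. B * q ^ i)"
    using assms by (intro summable_mult summable_geometric) auto
  show "norm (q ^ i * b i) \<le> B * q ^ i" for i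
    using mult_right_mono[OF assms(3)[of i], of "q ^ i"] assms(1) by (simp add: abs_mult power_abs mult.commute)
qed

text \<open>The Cauchy-Schwarz inequality for the weights \<open>q ^ i\<close>, obtained by summing
  \<open>2 b m \<le> b\<^sup>2 + m\<^sup>2\<close> where \<open>m\<close> is the weighted mean of \<open>b\<close>.\<close>

lemma geometric_weight_square_le:
  fixes q :: real
  assumes q: "0 \<le> q" "q < 1" and b: "\<And>i. \<bar>b i\<bar> \<le> B"
  shows "(\<Sum>i. q ^ i * b i)\<^sup>2 \<le> (\<Sum>i. q ^ i * (b i)\<^sup>2) / (1 - q)"
proof -
  define S where "S = (\<Sum>i. q ^ i * b i)"
  define m where "m = S * (1 - q)"
  have s1: "summable (\<lambda>i. q ^ i * b i)"
    using geometric_weight_summable[OF q b] .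
  have s2: "summable (\<lambda>i. q ^ i * (b i)\<^sup>2)"
  proof (rule geometric_weight_summable[OF q])
    show "\<bar>(b i)\<^sup>2\<bar> \<le> B\<^sup>2" for i
      using power_mono[OF b[of i], of 2] by simp
  qed
  have s3: "(\<lambda>i. q ^ i) sums (1 / (1 - q))"
    using geometric_sums[of q] q by simp
  have "(\<lambda>i. 2 * m * (q ^ i * b i)) sums (2 * m * S)"
    unfolding S_def using s1 by (intro sums_mult summable_sums)
  moreover have "(\<lambda>i. q ^ i * (b i)\<^sup>2 + m\<^sup>2 * q ^ i) sums ((\<Sum>i. q ^ i * (b i)\<^sup>2) + m\<^sup>2 * (1 / (1 - q)))"
    using s2 s3 by (intro sums_add sums_mult summable_sums)
  moreover have "2 * m * (q ^ i * b i) \<le> q ^ i * (b i)\<^sup>2 + m\<^sup>2 * q ^ i" for i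
  proof -
    have "0 \<le> q ^ i * (b i - m)\<^sup>2"
      using q by simp
    then show ?thesis
      by (simp add: power2_eq_square algebra_simps)
  qed
  ultimately have "2 * m * S \<le> (\<Sum>i. q ^ i * (b i)\<^sup>2) + m\<^sup>2 * (1 / (1 - q))"
    by (metis (no_types, lifting) sums_le)
  moreover have "m\<^sup>2 * (1 / (1 - q)) = m * S"
    using q by (simp add: m_def power2_eq_square)
  ultimately have "m * S \<le> (\<Sum>i. q ^ i * (b i)\<^sup>2)"
    by linarith
  moreover have "m * S = S\<^sup>2 * (1 - q)"
    by (simp add: m_def power2_eq_square)
  ultimately show ?thesis
    using q by (simp add: S_def pos_le_divide_eq)
qed

section \<open>Clipped scaled moments and their coupling through the power series of the
  control\<close>

locale controlled_support =
  fixes \<mu>0 :: "real measure" and r \<rho> R K :: real and U :: "(nat \<Rightarrow> real) set"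
  assumes support: "measure_support \<mu>0 \<subseteq> {-r..r}"
    and radii: "0 < r" "r < \<rho>" "\<rho> < R"
    and K_pos: "0 < K"
    and control: "control_set R K U"
begin

abbreviation \<P> :: "real measure set" where
  "\<P> \<equiv> prob_measures_within \<mu>0"

text \<open>On the support this is \<open>(x / \<rho>) ^ n\<close>; the truncation makes it bounded on the whole line.\<close>

definition scaled_power :: "nat \<Rightarrow> real \<Rightarrow> real" where
  "scaled_power n x = (max (- (r / \<rho>)) (min (r / \<rho>) (x / \<rho>))) ^ n"

definition moment :: "nat \<Rightarrow> real measure \<Rightarrow> real" where
  "moment n \<nu> = (\<integral>x. scaled_power n x \<partial>\<nu>)"

text \<open>The covariance of \<open>scaled_power n\<close> and the control function under \<nu>,
  that is, the integrand of the equation for this test function.\<close>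

definition volatility :: "nat \<Rightarrow> (nat \<Rightarrow> real) \<Rightarrow> real measure \<Rightarrow> real" where
  "volatility n v \<nu> = (\<integral>x. scaled_power n x * control_fun v x \<partial>\<nu>) - moment n \<nu> * (\<integral>x. control_fun v x \<partial>\<nu>)"

definition q :: real where "q = \<rho> / R"

lemma q_bounds: "0 \<le> q" "q < 1"
  using radii by (auto simp: q_def)

lemma real_distribution_P: "\<nu> \<in> \<P> \<Longrightarrow> real_distribution \<nu>"
  by (auto simp: prob_measures_within_def real_distribution_def real_distribution_axioms_def
      dest: sets_eq_imp_space_eq)

lemma AE_P: "\<nu> \<in> \<P> \<Longrightarrow> AE x in \<nu>. \<bar>x\<bar> \<le> r"
  using support
  by (fastforce simp: prob_measures_within_def abs_le_iff intro!: eventually_mono[OF AE_measure_support])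

lemma clip_abs_le: "\<bar>max (- (r / \<rho>)) (min (r / \<rho>) x)\<bar> \<le> r / \<rho>"
proof -
  have "0 \<le> r / \<rho>"
    using radii by auto
  then show ?thesis
    by (auto simp: max_def min_def abs_le_iff)
qed

lemma scaled_power_abs_le: "\<bar>scaled_power n x\<bar> \<le> 1"
  unfolding scaled_power_def power_abs
  by (rule power_le_one[OF abs_ge_zero order_trans[OF clip_abs_le]]) (use radii in auto)

lemma scaled_power_continuous: "scaled_power n \<in> bounded_continuous"
proof -
  have "continuous_on UNIV (scaled_power n)"
    unfolding scaled_power_def[abs_def] using radii by (intro continuous_intros) auto
  then show ?thesis
    using scaled_power_abs_le by (auto simp: bounded_continuous_def bounded_iff)
qed

lemma scaled_power_measurable[measurable]: "scaled_power n \<in> borel_measurable borel"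
  using scaled_power_continuous by (auto simp: bounded_continuous_def intro: borel_measurable_continuous_onI)

lemma scaled_power_eq: "\<bar>x\<bar> \<le> r \<Longrightarrow> scaled_power n x = (x / \<rho>) ^ n"
proof -
  assume "\<bar>x\<bar> \<le> r"
  then have "x / \<rho> \<le> r / \<rho>" "- (r / \<rho>) \<le> x / \<rho>"
    using radii by (auto simp: field_simps)
  then show ?thesis
    by (simp add: scaled_power_def)
qed

text \<open>Clipping does not increase distances and keeps the base within
  \<open>r / \<rho> < 1\<close>. The factor \<open>1 / \<rho>\<close> of the scaling and
  \<open>1 / (1 - r / \<rho>)\<close> of \<open>power_diff_le\<close> combine to a constant free of
  \<open>n\<close>.\<close>

lemma scaled_power_lipschitz: "\<bar>scaled_power n x - scaled_power n y\<bar> \<le> 1 / (\<rho> - r) * \<bar>x - y\<bar>"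
proof -
  let ?c = "\<lambda>x. max (- (r / \<rho>)) (min (r / \<rho>) (x / \<rho>))"
  have "\<bar>scaled_power n x - scaled_power n y\<bar> \<le> \<bar>?c x - ?c y\<bar> / (1 - r / \<rho>)"
    unfolding scaled_power_def using radii by (intro power_diff_le clip_abs_le) auto
  also have "\<dots> \<le> \<bar>x / \<rho> - y / \<rho>\<bar> / (1 - r / \<rho>)"
    using radii by (intro divide_right_mono) (auto simp: max_def min_def abs_if)
  also have "\<dots> = 1 / (\<rho> - r) * \<bar>x - y\<bar>"
    using radii by (simp add: field_simps abs_divide flip: diff_divide_distrib)
  finally show ?thesis .
qed

lemma scaled_power_integrable: "\<nu> \<in> \<P> \<Longrightarrow> integrable \<nu> (scaled_power n)"
  by (intro bounded_continuous_integrable scaled_power_continuous real_distribution_P)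

lemma moment_abs_le: "\<nu> \<in> \<P> \<Longrightarrow> \<bar>moment n \<nu>\<bar> \<le> 1"
proof -
  assume \<nu>: "\<nu> \<in> \<P>"
  then interpret real_distribution \<nu> by (rule real_distribution_P)
  have "\<bar>moment n \<nu>\<bar> \<le> (\<integral>x. \<bar>scaled_power n x\<bar> \<partial>\<nu>)"
    unfolding moment_def by (rule integral_abs_bound)
  also have "\<dots> \<le> (\<integral>x. 1 \<partial>\<nu>)"
    using scaled_power_integrable[OF \<nu>] scaled_power_abs_le by (intro integral_mono) auto
  finally show ?thesis
    using prob_space by simp
qed

lemma moment_diff_abs_le: "\<nu> \<in> \<P> \<Longrightarrow> \<nu>' \<in> \<P> \<Longrightarrow> \<bar>moment n \<nu> - moment n \<nu>'\<bar> \<le> 2"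
  using moment_abs_le[of \<nu> n] moment_abs_le[of \<nu>' n] by linarith

lemma moment_diff_wasserstein1_le:
  assumes "\<nu> \<in> \<P>" "\<nu>' \<in> \<P>"
  shows "ennreal \<bar>moment n \<nu> - moment n \<nu>'\<bar> \<le> ennreal (1 / (\<rho> - r)) * wasserstein1 \<nu> \<nu>'"
  unfolding moment_def using assms radii
  by (intro lipschitz_wasserstein1_le scaled_power_continuous scaled_power_lipschitz real_distribution_P) auto

text \<open>A single summand of the series of squares is at most \<open>K\<close>, so
  \<open>R ^ i * v i\<close> is bounded by \<open>sqrt K\<close>; the factor \<open>q ^ i\<close>
  then trades the radius \<open>R\<close> for \<rho>.\<close>

lemma control_coeff_le:
  assumes "v \<in> U"
  shows "\<bar>v i * \<rho> ^ i\<bar> \<le> sqrt K * q ^ i"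
proof -
  have "summable (\<lambda>i. (R ^ i * v i)\<^sup>2)" "(\<Sum>i. (R ^ i * v i)\<^sup>2) \<le> K"
    using assms control by (auto simp: control_set_def)
  then have "(R ^ i * v i)\<^sup>2 \<le> K"
    using sum_le_suminf[of "\<lambda>i. (R ^ i * v i)\<^sup>2" "{i}"] by simp
  then have "\<bar>R ^ i * v i\<bar> \<le> sqrt K"
    using real_le_rsqrt real_sqrt_le_mono by fastforce
  then have "\<bar>R ^ i * v i\<bar> * q ^ i \<le> sqrt K * q ^ i"
    using q_bounds by (intro mult_right_mono) auto
  moreover have "\<bar>R ^ i * v i\<bar> * q ^ i = \<bar>v i * \<rho> ^ i\<bar>"
    using radii by (simp add: q_def abs_mult power_divide)
  ultimately show ?thesis
    by simp
qed

lemma control_fun_measurable[measurable]: "control_fun v \<in> borel_measurable borel"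
  unfolding control_fun_def[abs_def] by measurable

text \<open>Multiplication by \<open>x ^ i\<close> shifts the moment index by \<open>i\<close> and
  costs \<open>\<rho> ^ i\<close>. The terms are dominated by \<open>sqrt K * q ^ i\<close>, which
  allows integration term by term.\<close>

lemma scaled_power_control_sums:
  assumes v: "v \<in> U" and \<nu>: "\<nu> \<in> \<P>"
  shows "(\<lambda>i. (v i * \<rho> ^ i) * moment (n + i) \<nu>) sums (\<integral>x. scaled_power n x * control_fun v x \<partial>\<nu>)"
proof -
  interpret real_distribution \<nu> using real_distribution_P[OF \<nu>] .
  let ?f = "\<lambda>i x. (v i * \<rho> ^ i) * scaled_power (n + i) x"
  have int: "integrable \<nu> (?f i)" for i
    using scaled_power_integrable[OF \<nu>] by simp
  have le: "norm (?f i x) \<le> sqrt K * q ^ i" for i x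
  proof -
    have "\<bar>v i * \<rho> ^ i\<bar> * \<bar>scaled_power (n + i) x\<bar> \<le> (sqrt K * q ^ i) * 1"
      using control_coeff_le[OF v] scaled_power_abs_le q_bounds K_pos by (intro mult_mono) auto
    then show ?thesis
      by (simp only: real_norm_def abs_mult mult_1_right)
  qed
  have geo: "summable (\<lambda>i. sqrt K * q ^ i)"
    using q_bounds by (intro summable_mult summable_geometric) auto
  have "(\<lambda>i. integral\<^sup>L \<nu> (?f i)) sums (\<integral>x. (\<Sum>i. ?f i x) \<partial>\<nu>)"
  proof (rule sums_integral)
    show "AE x in \<nu>. summable (\<lambda>i. norm (?f i x))"
      using le by (intro AE_I2 summable_comparison_test'[OF geo]) auto
    have "(\<integral>x. norm (?f i x) \<partial>\<nu>) \<le> (\<integral>x. sqrt K * q ^ i \<partial>\<nu>)" for i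
      using le by (intro integral_mono integrable_norm int) auto
    then show "summable (\<lambda>i. \<integral>x. norm (?f i x) \<partial>\<nu>)"
      using prob_space by (intro summable_comparison_test'[OF geo]) auto
  qed (rule int)
  moreover have "(\<integral>x. (\<Sum>i. ?f i x) \<partial>\<nu>) = (\<integral>x. scaled_power n x * control_fun v x \<partial>\<nu>)"
  proof (rule integral_cong_AE)
    show "AE x in \<nu>. (\<Sum>i. ?f i x) = scaled_power n x * control_fun v x"
      using AE_P[OF \<nu>]
    proof eventually_elim
      case (elim x)
      \<comment> \<open>The clipping is inactive because \<open>x\<close> lies in
        \<open>[-r, r]\<close>, so scaled powers multiply like ordinary ones.\<close>
      have *: "?f i x = scaled_power n x * (v i * x ^ i)" for i
        using radii elim by (simp add: scaled_power_eq power_add power_divide)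
      have "summable (\<lambda>i. v i * x ^ i)"
      proof (rule summable_comparison_test'[OF geo])
        show "norm (v i * x ^ i) \<le> sqrt K * q ^ i" for i
        proof -
          have "\<bar>v i\<bar> * \<bar>x\<bar> ^ i \<le> \<bar>v i\<bar> * \<rho> ^ i"
            using elim radii by (intro mult_left_mono power_mono) auto
          then show ?thesis
            using control_coeff_le[OF v, of i] radii by (simp add: abs_mult power_abs)
        qed
      qed
      then show ?case
        unfolding * control_fun_def by (rule suminf_mult)
    qed
  qed measurable
  ultimately show ?thesis
    using int by (simp add: moment_def)
qed

lemma weighted_moment_square_le:
  assumes c: "\<And>i. \<bar>c i\<bar> \<le> sqrt K * q ^ i" and b: "\<And>i. \<bar>b i\<bar> \<le> B"
    and S: "(\<lambda>i. c i * b i) sums S"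
  shows "S\<^sup>2 \<le> K / (1 - q) * (\<Sum>i. q ^ i * (b i)\<^sup>2)"
proof -
  have *: "(\<lambda>i. sqrt K * (q ^ i * \<bar>b i\<bar>)) sums (sqrt K * (\<Sum>i. q ^ i * \<bar>b i\<bar>))"
    by (intro sums_mult summable_sums geometric_weight_summable[OF q_bounds, of _ B]) (use b in auto)
  have "\<bar>c i * b i\<bar> \<le> sqrt K * (q ^ i * \<bar>b i\<bar>)" for i
    using mult_right_mono[OF c[of i], of "\<bar>b i\<bar>"] by (simp add: abs_mult mult.assoc)
  then have "c i * b i \<le> sqrt K * (q ^ i * \<bar>b i\<bar>)" "- (c i * b i) \<le> sqrt K * (q ^ i * \<bar>b i\<bar>)" for i
    by (smt (verit) abs_le_D1 abs_le_D2)+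
  from sums_le[OF this(1) S *] sums_le[OF this(2) sums_minus[OF S] *]
  have "\<bar>S\<bar> \<le> sqrt K * (\<Sum>i. q ^ i * \<bar>b i\<bar>)"
    by simp
  then have "S\<^sup>2 \<le> (sqrt K * (\<Sum>i. q ^ i * \<bar>b i\<bar>))\<^sup>2"
    using power_mono[of "\<bar>S\<bar>" _ 2] by simp
  also have "\<dots> = K * (\<Sum>i. q ^ i * \<bar>b i\<bar>)\<^sup>2"
    using K_pos by (simp add: power_mult_distrib)
  also have "\<dots> \<le> K * ((\<Sum>i. q ^ i * \<bar>b i\<bar>\<^sup>2) / (1 - q))"
    using K_pos b by (intro mult_left_mono geometric_weight_square_le[OF q_bounds, of _ B]) auto
  finally show ?thesis
    by simp
qed

text \<open>A product rule for the covariance: each of its three terms is linear in moment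
  differences, with coefficients bounded uniformly in \<open>v\<close> and \<open>n\<close>.\<close>

lemma volatility_diff_square_le:
  assumes v: "v \<in> U" and \<nu>: "\<nu> \<in> \<P>" "\<nu>' \<in> \<P>"
  defines "d \<equiv> \<lambda>i. moment i \<nu> - moment i \<nu>'"
  shows "(volatility n v \<nu> - volatility n v \<nu>')\<^sup>2 \<le>
    3 * K / (1 - q) * ((\<Sum>i. q ^ i * (d (n + i))\<^sup>2) + (d n)\<^sup>2 / (1 - q) + (\<Sum>i. q ^ i * (d i)\<^sup>2))"
proof -
  let ?A = "\<lambda>n \<nu>. \<integral>x. scaled_power n x * control_fun v x \<partial>\<nu>"
  let ?h = "\<lambda>\<nu>. \<integral>x. control_fun v x \<partial>\<nu>"
  \<comment> \<open>The power of degree 0 is the constant 1, so the mean of the control function is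
    covered by the same expansion.\<close>
  have h: "?h \<nu> = ?A 0 \<nu>" for \<nu>
    by (simp add: scaled_power_def)
  have A: "(\<lambda>i. (v i * \<rho> ^ i) * d (m + i)) sums (?A m \<nu> - ?A m \<nu>')" for m
    using sums_diff[OF scaled_power_control_sums[OF v \<nu>(1), of m] scaled_power_control_sums[OF v \<nu>(2), of m]]
    by (simp add: d_def right_diff_distrib)
  have d: "\<bar>d i\<bar> \<le> 2" for i
    unfolding d_def using moment_diff_abs_le \<nu> by blast
  have A_le: "(?A m \<nu> - ?A m \<nu>')\<^sup>2 \<le> K / (1 - q) * (\<Sum>i. q ^ i * (d (m + i))\<^sup>2)" for m
    by (rule weighted_moment_square_le[OF control_coeff_le[OF v] d A])
  have "\<bar>?h \<nu>\<bar> \<le> sqrt K * (1 / (1 - q))"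
  proof -
    have le: "\<bar>(v i * \<rho> ^ i) * moment (0 + i) \<nu>\<bar> \<le> sqrt K * q ^ i" for i
    proof -
      have "\<bar>v i * \<rho> ^ i\<bar> * \<bar>moment (0 + i) \<nu>\<bar> \<le> (sqrt K * q ^ i) * 1"
        using control_coeff_le[OF v] moment_abs_le[OF \<nu>(1)] q_bounds K_pos by (intro mult_mono) auto
      then show ?thesis
        by (simp only: abs_mult mult_1_right)
    qed
    have geo: "(\<lambda>i. sqrt K * q ^ i) sums (sqrt K * (1 / (1 - q)))"
      using q_bounds by (intro sums_mult geometric_sums) auto
    note S = scaled_power_control_sums[OF v \<nu>(1), of 0]
    have "?A 0 \<nu> \<le> sqrt K * (1 / (1 - q))"
      using le by (intro sums_le[OF _ S geo]) (simp add: abs_le_iff)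
    moreover have "- ?A 0 \<nu> \<le> sqrt K * (1 / (1 - q))"
      using le by (intro sums_le[OF _ sums_minus[OF S] geo]) (simp add: abs_le_iff)
    ultimately show ?thesis
      by (simp add: h)
  qed
  from power_mono[OF this abs_ge_zero, of 2]
  have h_le: "(?h \<nu>)\<^sup>2 \<le> K / (1 - q) * (1 / (1 - q))"
    using K_pos by (simp add: power_mult_distrib power2_eq_square)
  \<comment> \<open>The product of the \<open>n\<close>-th moment and the mean of the control
    function is split by changing one factor at a time.\<close>
  have split: "volatility n v \<nu> - volatility n v \<nu>'
      = (?A n \<nu> - ?A n \<nu>') + - (d n * ?h \<nu>) + - (moment n \<nu>' * (?h \<nu> - ?h \<nu>'))"
    by (simp add: volatility_def d_def algebra_simps)
  have "(volatility n v \<nu> - volatility n v \<nu>')\<^sup>2 \<le> 3 * ((?A n \<nu> - ?A n \<nu>')\<^sup>2 + (- (d n * ?h \<nu>))\<^sup>2 + (- (moment n \<nu>' * (?h \<nu> - ?h \<nu>')))\<^sup>2)"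
    unfolding split by (rule square_sum3_le)
  also have "\<dots> = 3 * ((?A n \<nu> - ?A n \<nu>')\<^sup>2 + (d n)\<^sup>2 * (?h \<nu>)\<^sup>2 + (moment n \<nu>')\<^sup>2 * (?A 0 \<nu> - ?A 0 \<nu>')\<^sup>2)"
    unfolding h by (simp add: power_mult_distrib)
  also have "\<dots> \<le> 3 * (K / (1 - q) * (\<Sum>i. q ^ i * (d (n + i))\<^sup>2) +
      (d n)\<^sup>2 * (K / (1 - q) * (1 / (1 - q))) + 1 * (K / (1 - q) * (\<Sum>i. q ^ i * (d (0 + i))\<^sup>2)))"
    using moment_abs_le[OF \<nu>(2), of n]
    by (intro mult_left_mono add_mono mult_mono A_le h_le) (auto simp: abs_square_le_1)
  finally show ?thesis
    by (simp add: distrib_left mult_ac)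
qed

end

section \<open>The Gronwall estimate\<close>

text \<open>Instead of assuming measurability of the supremum of \<open>e\<close>, the bound is improved
  iteratively: each step halves the excess over \<open>4 * A\<close>.\<close>

lemma gronwall_iterate:
  fixes e :: "'i \<Rightarrow> real \<Rightarrow> ennreal" and A B c :: real
  assumes nonneg: "0 \<le> A" "0 \<le> B" and "0 < c"
    and bounded: "\<And>n t. 0 \<le> t \<Longrightarrow> e n t \<le> ennreal B"
    and step: "\<And>G n t. 0 \<le> t \<Longrightarrow> G \<in> borel_measurable borel \<Longrightarrow> (\<And>s. 0 \<le> G s) \<Longrightarrow>
      (\<And>m s. 0 \<le> s \<Longrightarrow> s \<le> t \<Longrightarrow> e m s \<le> ennreal (G s)) \<Longrightarrow>
      e n t \<le> ennreal (2 * A) + ennreal c * (\<integral>\<^sup>+s\<in>{0..t}. ennreal (G s) \<partial>lborel)"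
    and "0 \<le> t"
  shows "e n t \<le> ennreal (4 * A * exp (2 * c * t))"
proof -
  have iter: "0 \<le> t \<Longrightarrow> e n t \<le> ennreal ((4 * A + B / 2 ^ k) * exp (2 * c * t))" for k n t
  proof (induction k arbitrary: n t)
    case 0
    have "B * 1 \<le> (4 * A + B) * exp (2 * c * t)"
      using 0 assms by (intro mult_mono) auto
    then show ?case
      using order_trans[OF bounded[OF 0] ennreal_leI] by simp
  next
    case (Suc k)
    define N where "N = 4 * A + B / 2 ^ k"
    have N: "0 \<le> N"
      using nonneg by (simp add: N_def)
    \<comment> \<open>The rate \<open>2 * c\<close> makes the integral term at most half of
      \<open>N * exp (2 * c * t)\<close>. With the summand \<open>2 * A\<close> this replaces
      \<open>N\<close> by \<open>2 * A + N / 2\<close>, a map whose fixed point is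
      \<open>4 * A\<close>.\<close>
    have "(\<integral>\<^sup>+s\<in>{0..t}. ennreal (N * exp (2 * c * s)) \<partial>lborel)
        = ennreal (N * exp (2 * c * t) / (2 * c) - N * exp (2 * c * 0) / (2 * c))"
      using N \<open>0 < c\<close> Suc.prems
      by (intro nn_integral_FTC_Icc) (auto intro!: derivative_eq_intros)
    also have "\<dots> \<le> ennreal (N * exp (2 * c * t) / (2 * c))"
      using N \<open>0 < c\<close> by (intro ennreal_leI) simp
    finally have "ennreal c * (\<integral>\<^sup>+s\<in>{0..t}. ennreal (N * exp (2 * c * s)) \<partial>lborel)
        \<le> ennreal c * ennreal (N * exp (2 * c * t) / (2 * c))"
      by (rule mult_left_mono) simp
    also have "\<dots> = ennreal (N * exp (2 * c * t) / 2)"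
      using N \<open>0 < c\<close> by (simp flip: ennreal_mult)
    finally have int: "ennreal c * (\<integral>\<^sup>+s\<in>{0..t}. ennreal (N * exp (2 * c * s)) \<partial>lborel)
        \<le> ennreal (N * exp (2 * c * t) / 2)" .
    have "e n t \<le> ennreal (2 * A) + ennreal c * (\<integral>\<^sup>+s\<in>{0..t}. ennreal (N * exp (2 * c * s)) \<partial>lborel)"
      using Suc.prems N Suc.IH by (intro step) (auto simp: N_def)
    also have "\<dots> \<le> ennreal (2 * A) + ennreal (N * exp (2 * c * t) / 2)"
      using int by (rule add_left_mono)
    also have "\<dots> = ennreal (2 * A + N * exp (2 * c * t) / 2)"
      using nonneg N by (simp add: ennreal_plus)
    also have "\<dots> \<le> ennreal ((4 * A + B / 2 ^ Suc k) * exp (2 * c * t))"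
    proof (rule ennreal_leI)
      have "2 * A * 1 \<le> 2 * A * exp (2 * c * t)"
        using assms(3) Suc.prems nonneg by (intro mult_left_mono) auto
      moreover have "(4 * A + B / 2 ^ Suc k) * exp (2 * c * t)
          = 2 * A * exp (2 * c * t) + N * exp (2 * c * t) / 2"
        by (simp add: N_def algebra_simps add_divide_distrib)
      ultimately show "2 * A + N * exp (2 * c * t) / 2 \<le> (4 * A + B / 2 ^ Suc k) * exp (2 * c * t)"
        by linarith
    qed
    finally show ?case .
  qed
  have "(\<lambda>k. B * (1 / 2) ^ k) \<longlonglongrightarrow> B * 0"
    by (intro tendsto_mult tendsto_const LIMSEQ_power_zero) simp
  then have "(\<lambda>k. ennreal ((4 * A + B / 2 ^ k) * exp (2 * c * t)))
      \<longlonglongrightarrow> ennreal ((4 * A + 0) * exp (2 * c * t))"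
    by (intro tendsto_ennrealI tendsto_mult tendsto_add tendsto_const) (simp add: power_one_over field_simps)
  then show ?thesis
    using iter[OF \<open>0 \<le> t\<close>] by (intro LIMSEQ_le_const) auto
qed

section \<open>Mean-square stability of the moments of solutions\<close>

locale controlled_equation = brownian_filtration M F W + controlled_support \<mu>0 r \<rho> R K U
  for M :: "'a measure" and F W \<mu>0 r \<rho> R K U
begin

text \<open>Here \<open>162 = 2 * 9 * 9\<close>: a 2 from splitting off the initial value, a 9 from
  \<open>ito_integral_diff_le\<close>, and \<open>9 * K / (1 - q)\<^sup>2\<close> from
  \<open>volatility_diff_mean_square_le\<close>.\<close>

definition growth_rate :: real where
  "growth_rate = 162 * K / (1 - q)\<^sup>2"

lemma growth_rate_pos: "0 < growth_rate"
  using K_pos q_bounds by (simp add: growth_rate_def)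

lemma solution_in_P:
  "mvm_solution M F W \<mu>0 u \<mu> \<xi> \<Longrightarrow> 0 \<le> t \<Longrightarrow> \<omega> \<in> space M \<Longrightarrow> \<xi> t \<omega> \<in> \<P>"
  by (simp add: mvm_solution_def continuous_mvm_def)

lemma solution_integral_measurable:
  assumes "mvm_solution M F W \<mu>0 u \<mu> \<xi>" "0 \<le> t" "f \<in> bounded_continuous"
  shows "(\<lambda>\<omega>. \<integral>x. f x \<partial>\<xi> t \<omega>) \<in> borel_measurable M"
proof (rule measurable_filtrationD[OF assms(2)])
  show "(\<lambda>\<omega>. \<integral>x. f x \<partial>\<xi> t \<omega>) \<in> borel_measurable (F t)"
    using assms by (simp add: mvm_solution_def continuous_mvm_def martingale_def adapted_to_def)
qed

lemma solution_moment_measurable: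
  "mvm_solution M F W \<mu>0 u \<mu> \<xi> \<Longrightarrow> 0 \<le> t \<Longrightarrow> (\<lambda>\<omega>. moment n (\<xi> t \<omega>)) \<in> borel_measurable M"
  unfolding moment_def by (rule solution_integral_measurable[OF _ _ scaled_power_continuous])

lemma solution_moment_ito:
  assumes "mvm_solution M F W \<mu>0 u \<mu> \<xi>"
  shows "is_ito_integral M F W (\<lambda>s \<omega>. volatility n (u s \<omega>) (\<xi> s \<omega>))
    (\<lambda>t \<omega>. moment n (\<xi> t \<omega>) - moment n (\<xi> 0 \<omega>))"
  using assms scaled_power_continuous unfolding mvm_solution_def volatility_def moment_def by blast

lemma solution_moment_continuous:
  assumes "mvm_solution M F W \<mu>0 u \<mu> \<xi>" "\<omega> \<in> space M"
  shows "continuous_on {0..} (\<lambda>t. moment n (\<xi> t \<omega>))"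
  using assms scaled_power_continuous unfolding mvm_solution_def continuous_mvm_def moment_def by blast

text \<open>That \<open>u\<close> takes values in \<open>U\<close> is encoded in the target space of
  its measurability and is read off at the point \<open>(s, \<omega>)\<close> of the product over
  \<open>[0, s]\<close>.\<close>

lemma control_in_U:
  assumes "progressively_measurable F (restrict_space borel U) u" "0 \<le> s" "\<omega> \<in> space M"
  shows "u s \<omega> \<in> U"
proof -
  have "(\<lambda>(s, \<omega>). u s \<omega>) \<in> measurable (time_product s) (restrict_space borel U)"
    using progressively_measurable_time_product assms by blast
  moreover have "(s, \<omega>) \<in> space (time_product s)"
    using assms by (simp add: time_product_def space_pair_measure space_restrict_space)
  ultimately have "(\<lambda>(s, \<omega>). u s \<omega>) (s, \<omega>) \<in> space (restrict_space borel U)"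
    by (rule measurable_space)
  then show ?thesis
    by (simp add: space_restrict_space)
qed

text \<open>Sum and expectation are exchanged by monotone convergence, and the weights sum to
  \<open>1 / (1 - q)\<close>. The bound \<open>B\<close> makes the real series converge, so that it
  agrees with the extended one; it does not enter the estimate.\<close>

lemma nn_integral_geometric_weight_le:
  assumes d: "\<And>i. d i \<in> borel_measurable M" "\<And>i \<omega>. \<omega> \<in> space M \<Longrightarrow> \<bar>d i \<omega>\<bar> \<le> B"
    and G: "0 \<le> G" "\<And>i. (\<integral>\<^sup>+\<omega>. ennreal ((d i \<omega>)\<^sup>2) \<partial>M) \<le> ennreal G"
  shows "(\<integral>\<^sup>+\<omega>. ennreal (\<Sum>i. q ^ i * (d i \<omega>)\<^sup>2) \<partial>M) \<le> ennreal (G / (1 - q))"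
proof -
  note [measurable] = d(1)
  have geo: "(\<lambda>i. q ^ i * G) sums (1 / (1 - q) * G)"
    using q_bounds by (intro sums_mult2 geometric_sums) auto
  have "ennreal (\<Sum>i. q ^ i * (d i \<omega>)\<^sup>2) = (\<Sum>i. ennreal (q ^ i * (d i \<omega>)\<^sup>2))" if "\<omega> \<in> space M" for \<omega>
  proof -
    have "\<bar>(d i \<omega>)\<^sup>2\<bar> \<le> B\<^sup>2" for i
      using power_mono[OF d(2)[OF that, of i], of 2] by simp
    then have "summable (\<lambda>i. q ^ i * (d i \<omega>)\<^sup>2)"
      by (rule geometric_weight_summable[OF q_bounds])
    then show ?thesis
      using q_bounds by (intro suminf_ennreal2[symmetric]) auto
  qed
  then have "(\<integral>\<^sup>+\<omega>. ennreal (\<Sum>i. q ^ i * (d i \<omega>)\<^sup>2) \<partial>M) = (\<integral>\<^sup>+\<omega>. (\<Sum>i. ennreal (q ^ i * (d i \<omega>)\<^sup>2)) \<partial>M)"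
    by (rule nn_integral_cong)
  also have "\<dots> = (\<Sum>i. \<integral>\<^sup>+\<omega>. ennreal (q ^ i * (d i \<omega>)\<^sup>2) \<partial>M)"
    by (rule nn_integral_suminf) measurable
  also have "\<dots> \<le> (\<Sum>i. ennreal (q ^ i * G))"
  proof (rule suminf_le)
    fix i
    have "(\<integral>\<^sup>+\<omega>. ennreal (q ^ i * (d i \<omega>)\<^sup>2) \<partial>M) = ennreal (q ^ i) * (\<integral>\<^sup>+\<omega>. ennreal ((d i \<omega>)\<^sup>2) \<partial>M)"
      using q_bounds by (simp add: ennreal_mult nn_integral_cmult)
    also have "\<dots> \<le> ennreal (q ^ i) * ennreal G"
      by (intro mult_left_mono G) simp
    finally show "(\<integral>\<^sup>+\<omega>. ennreal (q ^ i * (d i \<omega>)\<^sup>2) \<partial>M) \<le> ennreal (q ^ i * G)"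
      using q_bounds G by (simp add: ennreal_mult)
  qed (auto intro: summableI)
  also have "\<dots> = ennreal (\<Sum>i. q ^ i * G)"
    using q_bounds G geo by (intro suminf_ennreal2) (auto simp: sums_iff)
  also have "(\<Sum>i. q ^ i * G) = G / (1 - q)"
    using geo by (simp add: sums_iff)
  finally show ?thesis .
qed

text \<open>Since \<open>G\<close> bounds all moment differences alike, the shifted sum is no worse
  than the unshifted one. Each of the three terms of \<open>volatility_diff_square_le\<close>
  contributes \<open>G / (1 - q)\<close>, with the prefactor \<open>3 * K / (1 - q)\<close>.\<close>

lemma volatility_diff_mean_square_le:
  assumes u: "progressively_measurable F (restrict_space borel U) u"
    and \<xi>: "mvm_solution M F W \<mu>0 u \<mu> \<xi>" and \<eta>: "mvm_solution M F W \<mu>0 u \<mu>' \<eta>"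
    and s: "0 \<le> s" and G: "0 \<le> G"
    and le: "\<And>n. (\<integral>\<^sup>+\<omega>. ennreal ((moment n (\<xi> s \<omega>) - moment n (\<eta> s \<omega>))\<^sup>2) \<partial>M) \<le> ennreal G"
  shows "(\<integral>\<^sup>+\<omega>. ennreal ((volatility n (u s \<omega>) (\<xi> s \<omega>) - volatility n (u s \<omega>) (\<eta> s \<omega>))\<^sup>2) \<partial>M)
    \<le> ennreal (9 * K / (1 - q)\<^sup>2 * G)"
proof -
  define d where "d i \<omega> = moment i (\<xi> s \<omega>) - moment i (\<eta> s \<omega>)" for i \<omega>
  define g where "g m \<omega> = (\<Sum>i. q ^ i * (d (m + i) \<omega>)\<^sup>2)" for m \<omega>
  have d[measurable]: "d i \<in> borel_measurable M" for i
    unfolding d_def[abs_def] using solution_moment_measurable \<xi> \<eta> s by (intro borel_measurable_diff) blast+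
  have g[measurable]: "g m \<in> borel_measurable M" for m
    unfolding g_def[abs_def] by measurable
  have d_le: "\<bar>d i \<omega>\<bar> \<le> 2" if "\<omega> \<in> space M" for i \<omega>
    unfolding d_def by (rule moment_diff_abs_le) (use solution_in_P \<xi> \<eta> s that in blast)+
  have le': "(\<integral>\<^sup>+\<omega>. ennreal ((d i \<omega>)\<^sup>2) \<partial>M) \<le> ennreal G" for i
    using le by (simp add: d_def)
  have g_le: "(\<integral>\<^sup>+\<omega>. ennreal (g m \<omega>) \<partial>M) \<le> ennreal (G / (1 - q))" for m
    unfolding g_def using d_le by (intro nn_integral_geometric_weight_le[of _ 2] d G le')
  have g_nonneg: "0 \<le> g m \<omega>" if "\<omega> \<in> space M" for m \<omega>
    unfolding g_def
  proof (rule suminf_nonneg)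
    have "\<bar>(d (m + i) \<omega>)\<^sup>2\<bar> \<le> 2\<^sup>2" for i
      using power_mono[OF d_le[OF that, of "m + i"], of 2] by simp
    then show "summable (\<lambda>i. q ^ i * (d (m + i) \<omega>)\<^sup>2)"
      by (rule geometric_weight_summable[OF q_bounds])
  qed (use q_bounds in auto)
  define a where "a = 3 * K / (1 - q)"
  have a: "0 \<le> a"
    using K_pos q_bounds by (simp add: a_def)
  have "(\<integral>\<^sup>+\<omega>. ennreal ((volatility n (u s \<omega>) (\<xi> s \<omega>) - volatility n (u s \<omega>) (\<eta> s \<omega>))\<^sup>2) \<partial>M)
    \<le> (\<integral>\<^sup>+\<omega>. ennreal a * (ennreal (g n \<omega>) + ennreal (1 / (1 - q)) * ennreal ((d n \<omega>)\<^sup>2) + ennreal (g 0 \<omega>)) \<partial>M)"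
  proof (rule nn_integral_mono)
    fix \<omega> assume \<omega>: "\<omega> \<in> space M"
    have "(volatility n (u s \<omega>) (\<xi> s \<omega>) - volatility n (u s \<omega>) (\<eta> s \<omega>))\<^sup>2
        \<le> a * (g n \<omega> + (d n \<omega>)\<^sup>2 / (1 - q) + g 0 \<omega>)"
      using volatility_diff_square_le[OF control_in_U[OF u s \<omega>] solution_in_P[OF \<xi> s \<omega>] solution_in_P[OF \<eta> s \<omega>], of n]
      by (simp add: a_def g_def d_def)
    also have "\<dots> = a * (g n \<omega> + 1 / (1 - q) * (d n \<omega>)\<^sup>2 + g 0 \<omega>)"
      by simp
    finally have "ennreal ((volatility n (u s \<omega>) (\<xi> s \<omega>) - volatility n (u s \<omega>) (\<eta> s \<omega>))\<^sup>2)
        \<le> ennreal (a * (g n \<omega> + 1 / (1 - q) * (d n \<omega>)\<^sup>2 + g 0 \<omega>))"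
      by (rule ennreal_leI)
    also have "\<dots> = ennreal a * (ennreal (g n \<omega>) + ennreal (1 / (1 - q)) * ennreal ((d n \<omega>)\<^sup>2) + ennreal (g 0 \<omega>))"
      using a g_nonneg[OF \<omega>] q_bounds
      by (simp only: ennreal_mult ennreal_plus add_nonneg_nonneg mult_nonneg_nonneg zero_le_power2
          zero_le_divide_1_iff diff_ge_0_iff_ge less_imp_le)
    finally show "ennreal ((volatility n (u s \<omega>) (\<xi> s \<omega>) - volatility n (u s \<omega>) (\<eta> s \<omega>))\<^sup>2)
        \<le> ennreal a * (ennreal (g n \<omega>) + ennreal (1 / (1 - q)) * ennreal ((d n \<omega>)\<^sup>2) + ennreal (g 0 \<omega>))" .
  qed
  also have "\<dots> = ennreal a * ((\<integral>\<^sup>+\<omega>. ennreal (g n \<omega>) \<partial>M) +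
      ennreal (1 / (1 - q)) * (\<integral>\<^sup>+\<omega>. ennreal ((d n \<omega>)\<^sup>2) \<partial>M) + (\<integral>\<^sup>+\<omega>. ennreal (g 0 \<omega>) \<partial>M))"
    by (simp add: nn_integral_cmult nn_integral_add)
  also have "\<dots> \<le> ennreal a * (ennreal (G / (1 - q)) + ennreal (1 / (1 - q)) * ennreal G + ennreal (G / (1 - q)))"
    by (intro mult_left_mono add_mono g_le le') auto
  also have "\<dots> = ennreal (a * (G / (1 - q) + 1 / (1 - q) * G + G / (1 - q)))"
    using a G q_bounds by (simp flip: ennreal_mult ennreal_plus)
  also have "a * (G / (1 - q) + 1 / (1 - q) * G + G / (1 - q)) = 9 * K / (1 - q)\<^sup>2 * G"
    by (simp add: a_def power2_eq_square)
  finally show ?thesis .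
qed

text \<open>A moment difference is its initial value plus a difference of Ito integrals, separated
  by \<open>(a + y)\<^sup>2 \<le> 2 * a\<^sup>2 + 2 * y\<^sup>2\<close>. The majorant
  \<open>G\<close> is arbitrary, which gives the result the form of the hypothesis
  \<open>step\<close> of \<open>gronwall_iterate\<close>.\<close>

lemma moment_diff_step:
  assumes u: "progressively_measurable F (restrict_space borel U) u"
    and \<xi>: "mvm_solution M F W \<mu>0 u \<mu> \<xi>" and \<eta>: "mvm_solution M F W \<mu>0 u \<mu>' \<eta>"
    and A: "\<And>n. (moment n \<mu> - moment n \<mu>')\<^sup>2 \<le> A" and t: "0 \<le> t"
    and G: "G \<in> borel_measurable borel" "\<And>s. 0 \<le> G s"
    and le: "\<And>n s. 0 \<le> s \<Longrightarrow> s \<le> t \<Longrightarrow>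
      (\<integral>\<^sup>+\<omega>. ennreal ((moment n (\<xi> s \<omega>) - moment n (\<eta> s \<omega>))\<^sup>2) \<partial>M) \<le> ennreal (G s)"
  shows "(\<integral>\<^sup>+\<omega>. ennreal ((moment n (\<xi> t \<omega>) - moment n (\<eta> t \<omega>))\<^sup>2) \<partial>M)
    \<le> ennreal (2 * A) + ennreal growth_rate * (\<integral>\<^sup>+s\<in>{0..t}. ennreal (G s) \<partial>lborel)"
proof -
  define I where "I t \<omega> = moment n (\<xi> t \<omega>) - moment n (\<xi> 0 \<omega>)" for t \<omega>
  define J where "J t \<omega> = moment n (\<eta> t \<omega>) - moment n (\<eta> 0 \<omega>)" for t \<omega>
  have [measurable]: "I t \<in> borel_measurable M" "J t \<in> borel_measurable M"
    unfolding I_def J_def using solution_moment_measurable[OF \<xi>] solution_moment_measurable[OF \<eta>] t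
    by (auto intro!: borel_measurable_diff)
  note [measurable] = G(1)
  have A0: "0 \<le> A"
    using order_trans[OF zero_le_power2 A] .
  define b where "b = 9 * K / (1 - q)\<^sup>2"
  have b: "0 \<le> b"
    using K_pos by (simp add: b_def)
  have "(\<integral>\<^sup>+\<omega>. ennreal ((I t \<omega> - J t \<omega>)\<^sup>2) \<partial>M) \<le> 9 * (\<integral>\<^sup>+s\<in>{0..t}.
      (\<integral>\<^sup>+\<omega>. ennreal ((volatility n (u s \<omega>) (\<xi> s \<omega>) - volatility n (u s \<omega>) (\<eta> s \<omega>))\<^sup>2) \<partial>M) \<partial>lborel)"
    unfolding I_def J_def
    by (rule ito_integral_diff_le[OF solution_moment_ito[OF \<xi>] solution_moment_ito[OF \<eta>] t])
  also have "\<dots> \<le> 9 * (\<integral>\<^sup>+s\<in>{0..t}. ennreal b * ennreal (G s) \<partial>lborel)"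
  proof (intro mult_left_mono nn_integral_mono)
    fix s
    show "(\<integral>\<^sup>+\<omega>. ennreal ((volatility n (u s \<omega>) (\<xi> s \<omega>) - volatility n (u s \<omega>) (\<eta> s \<omega>))\<^sup>2) \<partial>M) * indicator {0..t} s
        \<le> ennreal b * ennreal (G s) * indicator {0..t} s"
    proof (cases "s \<in> {0..t}")
      case True
      then show ?thesis
        using volatility_diff_mean_square_le[OF u \<xi> \<eta> _ G(2) le, of s n] b G(2)
        by (simp add: b_def flip: ennreal_mult)
    qed simp
  qed simp
  also have "\<dots> = ennreal (9 * b) * (\<integral>\<^sup>+s\<in>{0..t}. ennreal (G s) \<partial>lborel)"
    using b by (simp add: mult.assoc nn_integral_cmult ennreal_mult)
  finally have IJ: "(\<integral>\<^sup>+\<omega>. ennreal ((I t \<omega> - J t \<omega>)\<^sup>2) \<partial>M)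
      \<le> ennreal (9 * b) * (\<integral>\<^sup>+s\<in>{0..t}. ennreal (G s) \<partial>lborel)" .
  have "AE \<omega> in M. ennreal ((moment n (\<xi> t \<omega>) - moment n (\<eta> t \<omega>))\<^sup>2)
      \<le> ennreal (2 * A) + 2 * ennreal ((I t \<omega> - J t \<omega>)\<^sup>2)"
  proof -
    have "AE \<omega> in M. \<xi> 0 \<omega> = \<mu>" "AE \<omega> in M. \<eta> 0 \<omega> = \<mu>'"
      using \<xi> \<eta> by (simp_all add: mvm_solution_def)
    then show ?thesis
    proof eventually_elim
      case (elim \<omega>)
      let ?a = "moment n \<mu> - moment n \<mu>'" and ?y = "I t \<omega> - J t \<omega>"
      have "moment n (\<xi> t \<omega>) - moment n (\<eta> t \<omega>) = ?a + ?y"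
        using elim by (simp add: I_def J_def)
      moreover have "(?a + ?y)\<^sup>2 \<le> 2 * ?a\<^sup>2 + 2 * ?y\<^sup>2"
      proof -
        have "0 \<le> (?a - ?y)\<^sup>2"
          by simp
        then show ?thesis
          by (simp only: power2_eq_square) (simp add: algebra_simps)
      qed
      ultimately have "(moment n (\<xi> t \<omega>) - moment n (\<eta> t \<omega>))\<^sup>2 \<le> 2 * A + 2 * ?y\<^sup>2"
        using A[of n] by simp
      then have "ennreal ((moment n (\<xi> t \<omega>) - moment n (\<eta> t \<omega>))\<^sup>2) \<le> ennreal (2 * A + 2 * ?y\<^sup>2)"
        by (rule ennreal_leI)
      then show ?case
        using A0 by (simp add: ennreal_plus ennreal_mult)
    qed
  qed
  then have "(\<integral>\<^sup>+\<omega>. ennreal ((moment n (\<xi> t \<omega>) - moment n (\<eta> t \<omega>))\<^sup>2) \<partial>M)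
      \<le> (\<integral>\<^sup>+\<omega>. ennreal (2 * A) + 2 * ennreal ((I t \<omega> - J t \<omega>)\<^sup>2) \<partial>M)"
    by (rule nn_integral_mono_AE)
  also have "\<dots> = ennreal (2 * A) + 2 * (\<integral>\<^sup>+\<omega>. ennreal ((I t \<omega> - J t \<omega>)\<^sup>2) \<partial>M)"
    by (simp add: nn_integral_add nn_integral_cmult emeasure_space_1)
  also have "\<dots> \<le> ennreal (2 * A) + 2 * (ennreal (9 * b) * (\<integral>\<^sup>+s\<in>{0..t}. ennreal (G s) \<partial>lborel))"
    using IJ by (intro add_left_mono mult_left_mono) auto
  also have "2 * (ennreal (9 * b) * (\<integral>\<^sup>+s\<in>{0..t}. ennreal (G s) \<partial>lborel))
      = ennreal growth_rate * (\<integral>\<^sup>+s\<in>{0..t}. ennreal (G s) \<partial>lborel)"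
  proof -
    have "2 * ennreal (9 * b) = ennreal (2 * (9 * b))"
      using b by (simp add: ennreal_mult)
    also have "2 * (9 * b) = growth_rate"
      by (simp add: b_def growth_rate_def)
    finally show ?thesis
      by (simp add: mult.assoc[symmetric])
  qed
  finally show ?thesis .
qed

theorem moment_diff_stability:
  assumes u: "progressively_measurable F (restrict_space borel U) u"
    and \<xi>: "mvm_solution M F W \<mu>0 u \<mu> \<xi>" and \<eta>: "mvm_solution M F W \<mu>0 u \<mu>' \<eta>"
    and A: "\<And>n. (moment n \<mu> - moment n \<mu>')\<^sup>2 \<le> A" and t: "0 \<le> t"
  shows "(\<integral>\<^sup>+\<omega>. ennreal ((moment n (\<xi> t \<omega>) - moment n (\<eta> t \<omega>))\<^sup>2) \<partial>M)
    \<le> ennreal (4 * A * exp (2 * growth_rate * t))"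
proof (rule gronwall_iterate[where e = "\<lambda>n t. \<integral>\<^sup>+\<omega>. ennreal ((moment n (\<xi> t \<omega>) - moment n (\<eta> t \<omega>))\<^sup>2) \<partial>M" and B = 4])
  \<comment> \<open>Scaled moments lie in \<open>[-1, 1]\<close>, which yields the a priori bound
    \<open>B = 4\<close> that starts the iteration.\<close>
  fix n t assume t: "0 \<le> (t :: real)"
  have "(\<integral>\<^sup>+\<omega>. ennreal ((moment n (\<xi> t \<omega>) - moment n (\<eta> t \<omega>))\<^sup>2) \<partial>M) \<le> (\<integral>\<^sup>+\<omega>. ennreal 4 \<partial>M)"
  proof (intro nn_integral_mono ennreal_leI)
    fix \<omega> assume "\<omega> \<in> space M"
    then have "\<bar>moment n (\<xi> t \<omega>) - moment n (\<eta> t \<omega>)\<bar> \<le> 2"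
      using solution_in_P[OF \<xi> t] solution_in_P[OF \<eta> t] by (intro moment_diff_abs_le)
    from power_mono[OF this, of 2] show "(moment n (\<xi> t \<omega>) - moment n (\<eta> t \<omega>))\<^sup>2 \<le> 4"
      by simp
  qed
  then show "(\<integral>\<^sup>+\<omega>. ennreal ((moment n (\<xi> t \<omega>) - moment n (\<eta> t \<omega>))\<^sup>2) \<partial>M) \<le> ennreal 4"
    by (simp add: emeasure_space_1)
next
  show "0 \<le> A"
    using order_trans[OF zero_le_power2 A] .
qed (use moment_diff_step[OF u \<xi> \<eta> A] growth_rate_pos t in auto)

end

section \<open>Convergence of moments and of measures\<close>

text \<open>This is nonnegativity of the variance of \<open>\<bar>X\<bar>\<close>; the bound
  \<open>C\<close> supplies integrability.\<close>

lemma (in prob_space) expectation_abs_le_sqrt: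
  fixes X :: "'a \<Rightarrow> real"
  assumes X: "X \<in> borel_measurable M" "\<And>\<omega>. \<omega> \<in> space M \<Longrightarrow> \<bar>X \<omega>\<bar> \<le> C"
    and le: "(\<integral>\<^sup>+\<omega>. ennreal ((X \<omega>)\<^sup>2) \<partial>M) \<le> ennreal B" and "0 \<le> B"
  shows "expectation (\<lambda>\<omega>. \<bar>X \<omega>\<bar>) \<le> sqrt B"
proof -
  note [measurable] = X(1)
  have i1: "integrable M (\<lambda>\<omega>. \<bar>X \<omega>\<bar>)"
    by (rule integrable_const_bound[of _ C]) (use X(2) in auto)
  have i2: "integrable M (\<lambda>\<omega>. (X \<omega>)\<^sup>2)"
  proof (rule integrable_const_bound[of _ "C\<^sup>2"])
    show "AE \<omega> in M. norm ((X \<omega>)\<^sup>2) \<le> C\<^sup>2"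
      using power_mono[OF X(2), of _ 2] by (intro AE_I2) auto
  qed measurable
  have "0 \<le> variance (\<lambda>\<omega>. \<bar>X \<omega>\<bar>)"
    by (rule variance_positive)
  also have "\<dots> = expectation (\<lambda>\<omega>. (X \<omega>)\<^sup>2) - (expectation (\<lambda>\<omega>. \<bar>X \<omega>\<bar>))\<^sup>2"
    using variance_eq[OF i1] i2 by simp
  finally have "(expectation (\<lambda>\<omega>. \<bar>X \<omega>\<bar>))\<^sup>2 \<le> expectation (\<lambda>\<omega>. (X \<omega>)\<^sup>2)"
    by simp
  also have "\<dots> \<le> B"
    using le \<open>0 \<le> B\<close> by (simp add: nn_integral_eq_integral[OF i2])
  finally show ?thesis
    by (rule real_le_rsqrt)
qed

context controlled_support
begin

text \<open>Weierstrass approximation on \<open>[-r, r]\<close> costs \<open>e / 2\<close> for each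
  of the two measures, and there a polynomial is a combination of scaled powers. The choice of
  \<open>N\<close> and \<open>c\<close> precedes that of the measures, so the bound can be used
  under an expectation and along sequences.\<close>

lemma integral_diff_le_moments:
  assumes f: "f \<in> bounded_continuous" and "0 < e"
  shows "\<exists>N c. (\<forall>i. 0 \<le> c i) \<and> (\<forall>\<nu>\<in>\<P>. \<forall>\<nu>'\<in>\<P>.
      \<bar>(\<integral>x. f x \<partial>\<nu>) - (\<integral>x. f x \<partial>\<nu>')\<bar> \<le> e + (\<Sum>i\<le>N. c i * \<bar>moment i \<nu> - moment i \<nu>'\<bar>))"
proof -
  have "continuous_on {-r..r} f"
    using f by (auto simp: bounded_continuous_def intro: continuous_on_subset)
  then obtain g where g: "real_polynomial_function g" "\<And>x. x \<in> {-r..r} \<Longrightarrow> \<bar>f x - g x\<bar> < e / 2"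
    using Stone_Weierstrass_real_polynomial_function[of "{-r..r}" f "e / 2"] \<open>0 < e\<close> by auto
  obtain a N where a: "g = (\<lambda>x. \<Sum>i\<le>N. a i * x ^ i)"
    using g(1) by (auto simp: real_polynomial_function_iff_sum)
  define b where "b i = a i * \<rho> ^ i" for i
  have approx: "\<bar>(\<integral>x. f x \<partial>\<nu>) - (\<Sum>i\<le>N. b i * moment i \<nu>)\<bar> \<le> e / 2" if \<nu>: "\<nu> \<in> \<P>" for \<nu>
  proof -
    interpret real_distribution \<nu> using real_distribution_P[OF \<nu>] .
    have i: "integrable \<nu> f" "integrable \<nu> (\<lambda>x. \<Sum>i\<le>N. b i * scaled_power i x)"
      using bounded_continuous_integrable[OF f] scaled_power_integrable[OF \<nu>] real_distribution_P[OF \<nu>] by auto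
    have "(\<integral>x. f x \<partial>\<nu>) - (\<Sum>i\<le>N. b i * moment i \<nu>) = (\<integral>x. f x - (\<Sum>i\<le>N. b i * scaled_power i x) \<partial>\<nu>)"
      using i scaled_power_integrable[OF \<nu>] by (simp add: moment_def)
    also have "\<bar>\<dots>\<bar> \<le> (\<integral>x. \<bar>f x - (\<Sum>i\<le>N. b i * scaled_power i x)\<bar> \<partial>\<nu>)"
      by (rule integral_abs_bound)
    also have "\<dots> \<le> (\<integral>x. e / 2 \<partial>\<nu>)"
    proof (rule integral_mono_AE)
      show "AE x in \<nu>. \<bar>f x - (\<Sum>i\<le>N. b i * scaled_power i x)\<bar> \<le> e / 2"
        using AE_P[OF \<nu>]
      proof eventually_elim
        case (elim x)
        then have "(\<Sum>i\<le>N. b i * scaled_power i x) = g x"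
          using radii by (simp add: a b_def scaled_power_eq power_divide)
        then show ?case
          using g(2)[of x] elim by (simp add: abs_le_iff)
      qed
    qed (use i in auto)
    also have "\<dots> = e / 2"
      using prob_space by simp
    finally show ?thesis .
  qed
  show ?thesis
  proof (intro exI[of _ N] exI[of _ "\<lambda>i. \<bar>b i\<bar>"] conjI allI ballI)
    show "0 \<le> \<bar>b i\<bar>" for i
      by simp
    fix \<nu> \<nu>' assume \<nu>: "\<nu> \<in> \<P>" "\<nu>' \<in> \<P>"
    have "(\<Sum>i\<le>N. b i * moment i \<nu>) - (\<Sum>i\<le>N. b i * moment i \<nu>')
        = (\<Sum>i\<le>N. b i * (moment i \<nu> - moment i \<nu>'))"
      by (simp add: sum_subtractf right_diff_distrib)
    also have "\<bar>\<dots>\<bar> \<le> (\<Sum>i\<le>N. \<bar>b i\<bar> * \<bar>moment i \<nu> - moment i \<nu>'\<bar>)"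
      using sum_abs[of "\<lambda>i. b i * (moment i \<nu> - moment i \<nu>')" "{..N}"] by (simp only: abs_mult)
    finally show "\<bar>(\<integral>x. f x \<partial>\<nu>) - (\<integral>x. f x \<partial>\<nu>')\<bar> \<le> e + (\<Sum>i\<le>N. \<bar>b i\<bar> * \<bar>moment i \<nu> - moment i \<nu>'\<bar>)"
      using approx[OF \<nu>(1)] approx[OF \<nu>(2)] by linarith
  qed
qed

text \<open>With equal moments the previous bound leaves only \<open>e\<close>, so integrals of
  bounded continuous functions agree. Cosine and sine then give the characteristic function.\<close>

lemma moments_determine_measure:
  assumes \<nu>: "\<nu> \<in> \<P>" "\<nu>' \<in> \<P>" and eq: "\<And>n. moment n \<nu> = moment n \<nu>'"
  shows "\<nu> = \<nu>'"
proof (rule Levy_uniqueness)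
  show rd: "real_distribution \<nu>" "real_distribution \<nu>'"
    using \<nu> by (simp_all add: real_distribution_P)
  have f: "(\<integral>x. f x \<partial>\<nu>) = (\<integral>x. f x \<partial>\<nu>')" if fb: "f \<in> bounded_continuous" for f
  proof (rule ccontr)
    assume "(\<integral>x. f x \<partial>\<nu>) \<noteq> (\<integral>x. f x \<partial>\<nu>')"
    then have pos: "0 < \<bar>(\<integral>x. f x \<partial>\<nu>) - (\<integral>x. f x \<partial>\<nu>')\<bar> / 2"
      by simp
    obtain N c where "\<bar>(\<integral>x. f x \<partial>\<nu>) - (\<integral>x. f x \<partial>\<nu>')\<bar>
        \<le> \<bar>(\<integral>x. f x \<partial>\<nu>) - (\<integral>x. f x \<partial>\<nu>')\<bar> / 2 + (\<Sum>i\<le>N. c i * \<bar>moment i \<nu> - moment i \<nu>'\<bar>)"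
      using integral_diff_le_moments[OF fb pos] \<nu> by blast
    with pos show False
      by (simp add: eq)
  qed
  have iexp: "integrable \<nu> (\<lambda>x. iexp (t * x))" "integrable \<nu>' (\<lambda>x. iexp (t * x))" for t
  proof -
    interpret real_distribution \<nu> using rd(1) .
    show "integrable \<nu> (\<lambda>x. iexp (t * x))"
      by (rule integrable_iexp) auto
    interpret \<nu>': real_distribution \<nu>' using rd(2) .
    show "integrable \<nu>' (\<lambda>x. iexp (t * x))"
      by (rule \<nu>'.integrable_iexp) auto
  qed
  have bc: "(\<lambda>x. cos (t * x)) \<in> bounded_continuous" "(\<lambda>x. sin (t * x)) \<in> bounded_continuous" for t :: real
    by (auto simp: bounded_continuous_def bounded_iff intro!: continuous_intros exI[of _ 1])
  show "char \<nu> = char \<nu>'"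
  proof
    fix t
    have "Re (char \<nu> t) = Re (char \<nu>' t)" "Im (char \<nu> t) = Im (char \<nu>' t)"
      unfolding char_def using iexp f[OF bc(1)] f[OF bc(2)]
      by (simp_all add: Re_exp Im_exp flip: integral_Re integral_Im)
    then show "char \<nu> t = char \<nu>' t"
      by (rule complex_eqI)
  qed
qed

text \<open>Both sequences may fail to converge, but along a subsequence they converge weakly to a common
  limit. Interleaving them yields a single sequence, so that Skorohod's theorem represents both on
  one probability space, which provides the couplings.\<close>

theorem moments_wasserstein1_tendsto:
  assumes \<nu>: "\<And>k. \<nu> k \<in> \<P>" "\<And>k. \<nu>' k \<in> \<P>"
    and lim: "\<And>n. (\<lambda>k. moment n (\<nu> k) - moment n (\<nu>' k)) \<longlonglongrightarrow> 0"
  shows "(\<lambda>k. wasserstein1 (\<nu> k) (\<nu>' k)) \<longlonglongrightarrow> 0"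
proof (rule order_tendstoI)
  fix a :: ennreal assume "0 < a"
  show "\<forall>\<^sub>F k in sequentially. wasserstein1 (\<nu> k) (\<nu>' k) < a"
  proof (rule ccontr)
    assume "\<not> ?thesis"
    then obtain s :: "nat \<Rightarrow> nat" where s: "strict_mono s" "\<And>n. \<not> wasserstein1 (\<nu> (s n)) (\<nu>' (s n)) < a"
      using not_eventually_sequentiallyD[of "\<lambda>k. wasserstein1 (\<nu> k) (\<nu>' k) < a"] by blast
    have "tight \<nu>"
      unfolding tight_def
    proof (intro conjI allI impI)
      show "real_distribution (\<nu> n)" for n
        using \<nu>(1) by (rule real_distribution_P)
      fix e :: real assume "0 < e"
      \<comment> \<open>Tightness is phrased with half-open intervals, so the left end is moved
        below \<open>-r\<close> to keep a possible atom there.\<close>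
      have "measure (\<nu> n) {- r - 1<..r} = 1" for n
      proof -
        interpret real_distribution "\<nu> n" using \<nu>(1) by (rule real_distribution_P)
        show ?thesis
          using AE_P[OF \<nu>(1)[of n]] by (subst prob_eq_1) auto
      qed
      then show "\<exists>a b. a < b \<and> (\<forall>n. 1 - e < measure (\<nu> n) {a<..b})"
        using radii \<open>0 < e\<close> by (intro exI[of _ "- r - 1"] exI[of _ r]) auto
    qed
    from tight_imp_convergent_subsubsequence[OF this s(1)]
    obtain p \<nu>\<^sub>0 where p: "strict_mono p" and \<nu>0: "real_distribution \<nu>\<^sub>0" and weak: "weak_conv_m (\<nu> \<circ> s \<circ> p) \<nu>\<^sub>0"
      by auto
    define m where "m n = (if even n then \<nu> (s (p (n div 2))) else \<nu>' (s (p (n div 2))))" for n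
    have m_P: "m n \<in> \<P>" for n
      using \<nu> by (simp add: m_def)
    have rd: "real_distribution (m n)" for n
      using m_P by (rule real_distribution_P)
    have "weak_conv_m m \<nu>\<^sub>0"
    proof (rule integral_cts_step_conv_imp_weak_conv[OF rd \<nu>0])
      \<comment> \<open>Testing on \<open>cts_step\<close> suffices for weak convergence. Even
        indices converge by the choice of the subsequence, odd ones because close moments force
        close integrals.\<close>
      fix x y :: real assume "x < y"
      have cont: "isCont (cts_step x y) z" for z
        using uniformly_continuous_imp_continuous[OF cts_step_uniformly_continuous[OF \<open>x < y\<close>]]
        by (simp add: continuous_on_eq_continuous_at)
      have bd: "norm (cts_step x y z) \<le> 1" for z
        using \<open>x < y\<close> by (auto simp: cts_step_def)
      have bc: "cts_step x y \<in> bounded_continuous"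
        using cont bd by (auto simp: bounded_continuous_def bounded_iff continuous_at_imp_continuous_on)
      have l: "(\<lambda>n. integral\<^sup>L (\<nu> (s (p n))) (cts_step x y)) \<longlonglongrightarrow> integral\<^sup>L \<nu>\<^sub>0 (cts_step x y)"
        using weak_conv_imp_integral_bdd_continuous_conv[OF _ \<nu>0 weak, of "cts_step x y" 1]
          real_distribution_P[OF \<nu>(1)] cont bd by (simp add: comp_def)
      have "(\<lambda>k. integral\<^sup>L (\<nu>' k) (cts_step x y) - integral\<^sup>L (\<nu> k) (cts_step x y)) \<longlonglongrightarrow> 0"
      proof (rule LIMSEQ_I)
        fix e :: real assume "0 < e"
        then obtain N c where c: "\<forall>\<nu>\<in>\<P>. \<forall>\<nu>'\<in>\<P>.
            \<bar>(\<integral>x'. cts_step x y x' \<partial>\<nu>) - (\<integral>x'. cts_step x y x' \<partial>\<nu>')\<bar>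
              \<le> e / 2 + (\<Sum>i\<le>N. c i * \<bar>moment i \<nu> - moment i \<nu>'\<bar>)"
          using integral_diff_le_moments[OF bc, of "e / 2"] half_gt_zero[of e] by blast
        have "(\<lambda>k. \<Sum>i\<le>N. c i * \<bar>moment i (\<nu> k) - moment i (\<nu>' k)\<bar>) \<longlonglongrightarrow> (\<Sum>i\<le>N. c i * \<bar>0\<bar>)"
          by (intro tendsto_intros lim)
        then have "\<forall>\<^sub>F k in sequentially. (\<Sum>i\<le>N. c i * \<bar>moment i (\<nu> k) - moment i (\<nu>' k)\<bar>) < e / 2"
          using \<open>0 < e\<close> by (intro order_tendstoD) auto
        then have "\<forall>\<^sub>F k in sequentially.
            norm (integral\<^sup>L (\<nu>' k) (cts_step x y) - integral\<^sup>L (\<nu> k) (cts_step x y) - 0) < e"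
        proof eventually_elim
          case (elim k)
          then show ?case
            using c[rule_format, OF \<nu>(1)[of k] \<nu>(2)[of k]] by (simp add: abs_minus_commute)
        qed
        then show "\<exists>no. \<forall>k\<ge>no. norm (integral\<^sup>L (\<nu>' k) (cts_step x y) - integral\<^sup>L (\<nu> k) (cts_step x y) - 0) < e"
          by (simp add: eventually_sequentially)
      qed
      from LIMSEQ_subseq_LIMSEQ[OF this strict_mono_o[OF s(1) p]]
      have "(\<lambda>n. integral\<^sup>L (\<nu>' (s (p n))) (cts_step x y) - integral\<^sup>L (\<nu> (s (p n))) (cts_step x y)) \<longlonglongrightarrow> 0"
        by (simp add: comp_def)
      from tendsto_add[OF this l]
      have l': "(\<lambda>n. integral\<^sup>L (\<nu>' (s (p n))) (cts_step x y)) \<longlonglongrightarrow> integral\<^sup>L \<nu>\<^sub>0 (cts_step x y)"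
        by simp
      show "(\<lambda>n. integral\<^sup>L (m n) (cts_step x y)) \<longlonglongrightarrow> integral\<^sup>L \<nu>\<^sub>0 (cts_step x y)"
        by (rule limseq_even_odd) (use l l' in \<open>simp_all add: m_def\<close>)
    qed
    from Skorohod[OF rd \<nu>0 this] obtain \<Omega> :: "real measure" and Y Y0 where \<Omega>: "prob_space \<Omega>"
      and Y[measurable]: "\<And>n. Y n \<in> measurable \<Omega> borel" and dist: "\<And>n. distr \<Omega> borel (Y n) = m n"
      and Y_lim: "\<And>x. x \<in> space \<Omega> \<Longrightarrow> (\<lambda>n. Y n x) \<longlonglongrightarrow> Y0 x"
      by metis
    interpret \<Omega>: prob_space \<Omega> by fact
    let ?D = "\<lambda>n x. ennreal \<bar>Y (2 * n) x - Y (Suc (2 * n)) x\<bar>"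
    have le: "wasserstein1 (\<nu> (s (p n))) (\<nu>' (s (p n))) \<le> (\<integral>\<^sup>+x. ?D n x \<partial>\<Omega>)" for n
    proof -
      define \<pi> where "\<pi> = distr \<Omega> (borel \<Otimes>\<^sub>M borel) (\<lambda>x. (Y (2 * n) x, Y (Suc (2 * n)) x))"
      have "\<pi> \<in> couplings (\<nu> (s (p n))) (\<nu>' (s (p n)))"
        using dist[of "2 * n"] dist[of "Suc (2 * n)"]
        by (simp add: couplings_def \<pi>_def distr_distr comp_def m_def)
      then have "wasserstein1 (\<nu> (s (p n))) (\<nu>' (s (p n))) \<le> (\<integral>\<^sup>+z. ennreal \<bar>fst z - snd z\<bar> \<partial>\<pi>)"
        unfolding wasserstein1_def by (rule INF_lower)
      then show ?thesis
        by (simp add: \<pi>_def nn_integral_distr)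
    qed
    have bd: "AE x in \<Omega>. \<bar>Y n x\<bar> \<le> r" for n
      using AE_P[OF m_P[of n]] unfolding dist[symmetric] by (simp add: AE_distr_iff)
    have "(\<lambda>n. \<integral>\<^sup>+x. ?D n x \<partial>\<Omega>) \<longlonglongrightarrow> (\<integral>\<^sup>+x. 0 \<partial>\<Omega>)"
    proof (rule nn_integral_dominated_convergence[where w = "\<lambda>_. ennreal (2 * r)"])
      show "AE x in \<Omega>. ?D n x \<le> ennreal (2 * r)" for n
        using bd[of "2 * n"] bd[of "Suc (2 * n)"] by eventually_elim (intro ennreal_leI, linarith)
      show "(\<integral>\<^sup>+x. ennreal (2 * r) \<partial>\<Omega>) < \<infinity>"
        by (simp add: \<Omega>.emeasure_space_1)
      show "AE x in \<Omega>. (\<lambda>n. ?D n x) \<longlonglongrightarrow> 0"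
      proof (rule AE_I2)
        fix x assume "x \<in> space \<Omega>"
        note Yx = Y_lim[OF this]
        have "(\<lambda>n. Y (2 * n) x) \<longlonglongrightarrow> Y0 x" "(\<lambda>n. Y (Suc (2 * n)) x) \<longlonglongrightarrow> Y0 x"
          using LIMSEQ_subseq_LIMSEQ[OF Yx, of "\<lambda>n. 2 * n"] LIMSEQ_subseq_LIMSEQ[OF Yx, of "\<lambda>n. Suc (2 * n)"]
          by (simp_all add: strict_mono_def comp_def)
        from tendsto_ennrealI[OF tendsto_rabs[OF tendsto_diff[OF this]]]
        show "(\<lambda>n. ?D n x) \<longlonglongrightarrow> 0"
          by simp
      qed
    qed measurable
    then have "\<forall>\<^sub>F n in sequentially. (\<integral>\<^sup>+x. ?D n x \<partial>\<Omega>) < a"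
      using \<open>0 < a\<close> by (intro order_tendstoD) auto
    then obtain n where "(\<integral>\<^sup>+x. ?D n x \<partial>\<Omega>) < a"
      by (auto dest: eventually_happens)
    then show False
      using s(2)[of "p n"] le[of n] by (meson le_less_trans)
  qed
qed auto

end

section \<open>The stability theorem\<close>

text \<open>The largest absolute value is attained and hence strictly below \<open>R\<close>. The
  maximum with \<open>R / 2\<close> keeps \<open>r\<close> positive when the set is
  \<open>{0}\<close>.\<close>

lemma compact_subset_smaller_interval:
  fixes S :: "real set"
  assumes "compact S" "S \<subseteq> {-R<..<R}" "0 < R"
  obtains r where "0 < r" "r < R" "S \<subseteq> {-r..r}"
proof (cases "S = {}")
  case True
  then show ?thesis
    using that[of "R / 2"] assms by simp
next
  case False
  obtain y where y: "y \<in> S" "\<And>x. x \<in> S \<Longrightarrow> \<bar>x\<bar> \<le> \<bar>y\<bar>"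
    using continuous_attains_sup[OF assms(1) False, of abs] continuous_on_rabs[OF continuous_on_id] by auto
  then have "y \<in> {-R<..<R}"
    using assms(2) by blast
  moreover have "S \<subseteq> {- max \<bar>y\<bar> (R / 2)..max \<bar>y\<bar> (R / 2)}"
    using y(2) by (fastforce simp: abs_le_iff le_max_iff_disj)
  ultimately show ?thesis
    using that[of "max \<bar>y\<bar> (R / 2)"] assms(3) by auto
qed

context controlled_equation
begin

text \<open>Equal initial values allow \<open>A = 0\<close> in the stability bound, so each moment
  agrees almost surely at each time. Countably many moments and rational times share one null set;
  outside it, continuity of the moment paths reaches all times.\<close>

theorem solution_unique:
  assumes u: "progressively_measurable F (restrict_space borel U) u"
    and \<xi>: "mvm_solution M F W \<mu>0 u \<mu> \<xi>" and \<eta>: "mvm_solution M F W \<mu>0 u \<mu> \<eta>"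
  shows "indistinguishable M \<xi> \<eta>"
proof -
  have "AE \<omega> in M. moment n (\<xi> t \<omega>) = moment n (\<eta> t \<omega>)" if t: "0 \<le> t" for n t
  proof -
    have "(\<integral>\<^sup>+\<omega>. ennreal ((moment n (\<xi> t \<omega>) - moment n (\<eta> t \<omega>))\<^sup>2) \<partial>M) = 0"
      using moment_diff_stability[OF u \<xi> \<eta> _ t, of 0 n] by simp
    moreover have "(\<lambda>\<omega>. ennreal ((moment n (\<xi> t \<omega>) - moment n (\<eta> t \<omega>))\<^sup>2)) \<in> borel_measurable M"
      using solution_moment_measurable[OF \<xi> t, of n] solution_moment_measurable[OF \<eta> t, of n] by measurable
    ultimately have "AE \<omega> in M. ennreal ((moment n (\<xi> t \<omega>) - moment n (\<eta> t \<omega>))\<^sup>2) = 0"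
      by (simp only: nn_integral_0_iff_AE)
    then show ?thesis
      by eventually_elim simp
  qed
  then have "AE \<omega> in M. \<forall>n. \<forall>t\<in>\<rat> \<inter> {0..}. moment n (\<xi> t \<omega>) = moment n (\<eta> t \<omega>)"
    using countable_rat by (auto simp: AE_all_countable intro!: AE_ball_countable[THEN iffD2])
  moreover have "AE \<omega> in M. \<omega> \<in> space M"
    by simp
  ultimately have "AE \<omega> in M. \<forall>t\<ge>0. \<xi> t \<omega> = \<eta> t \<omega>"
  proof eventually_elim
    case (elim \<omega>)
    show ?case
    proof (intro allI impI)
      fix t :: real assume t: "0 \<le> t"
      \<comment> \<open>Approximation from the right keeps the rational times nonnegative even for
        \<open>t = 0\<close>.\<close>
      have "\<exists>p\<in>\<rat>. t < p \<and> p < t + 1 / Suc k" for k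
        by (rule Rats_dense_in_real) simp
      then obtain p where p: "\<And>k. p k \<in> \<rat>" "\<And>k. t < p k" "\<And>k. p k < t + 1 / Suc k"
        by metis
      have "(\<lambda>k. t + 1 / Suc k) \<longlonglongrightarrow> t + 0"
        by (intro tendsto_add tendsto_const LIMSEQ_inverse_real_of_nat[unfolded inverse_eq_divide])
      then have p_lim: "p \<longlonglongrightarrow> t"
        using p by (intro tendsto_sandwich[of "\<lambda>_. t" p _ "\<lambda>k. t + 1 / Suc k"]) (auto intro!: always_eventually less_imp_le)
      have "moment n (\<xi> t \<omega>) = moment n (\<eta> t \<omega>)" for n
      proof (rule LIMSEQ_unique)
        have p_ge: "\<forall>\<^sub>F k in sequentially. p k \<in> {0..}"
          using p(2) t by (intro always_eventually allI) (simp add: less_imp_le order.strict_trans1)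
        show "(\<lambda>k. moment n (\<xi> (p k) \<omega>)) \<longlonglongrightarrow> moment n (\<xi> t \<omega>)"
          using solution_moment_continuous[OF \<xi> elim(2)] p_lim _ p_ge
          by (rule continuous_on_tendsto_compose) (use t in simp)
        have "moment n (\<xi> (p k) \<omega>) = moment n (\<eta> (p k) \<omega>)" for k
          using elim(1) p(1,2)[of k] t by auto
        then show "(\<lambda>k. moment n (\<xi> (p k) \<omega>)) \<longlonglongrightarrow> moment n (\<eta> t \<omega>)"
          using continuous_on_tendsto_compose[OF solution_moment_continuous[OF \<eta> elim(2)] p_lim _ p_ge] t
          by simp
      qed
      then show "\<xi> t \<omega> = \<eta> t \<omega>"
        using solution_in_P[OF \<xi> t elim(2)] solution_in_P[OF \<eta> t elim(2)] by (intro moments_determine_measure)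
    qed
  qed
  then show ?thesis
    by (simp add: indistinguishable_def)
qed

section \<open>Convergence at a fixed time along varying controls\<close>

context
  fixes u :: "nat \<Rightarrow> real \<Rightarrow> 'a \<Rightarrow> nat \<Rightarrow> real" and \<mu>s :: "nat \<Rightarrow> real measure" and \<mu> :: "real measure"
    and \<xi> \<eta> :: "nat \<Rightarrow> real \<Rightarrow> 'a \<Rightarrow> real measure" and t :: real
  assumes u: "\<And>k. progressively_measurable F (restrict_space borel U) (u k)"
    and \<xi>: "\<And>k. mvm_solution M F W \<mu>0 (u k) (\<mu>s k) (\<xi> k)"
    and \<eta>: "\<And>k. mvm_solution M F W \<mu>0 (u k) \<mu> (\<eta> k)"
    and \<mu>s: "\<And>k. \<mu>s k \<in> \<P>" and \<mu>: "\<mu> \<in> \<P>"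
    and initial: "(\<lambda>k. wasserstein1 (\<mu>s k) \<mu>) \<longlonglongrightarrow> 0"
    and t: "0 \<le> t"
begin

lemma moment_diff_mean_square_bound:
  obtains B where "B \<longlonglongrightarrow> 0" "\<And>k. 0 \<le> B k"
    "\<forall>\<^sub>F k in sequentially. \<forall>n.
      (\<integral>\<^sup>+\<omega>. ennreal ((moment n (\<xi> k t \<omega>) - moment n (\<eta> k t \<omega>))\<^sup>2) \<partial>M) \<le> ennreal (B k)"
proof -
  define w where "w k = 1 / (\<rho> - r) * enn2real (wasserstein1 (\<mu>s k) \<mu>)" for k
  define B where "B k = 4 * (w k)\<^sup>2 * exp (2 * growth_rate * t)" for k
  have "w \<longlonglongrightarrow> 1 / (\<rho> - r) * 0"
    unfolding w_def using initial by (intro tendsto_intros) simp_all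
  then have "B \<longlonglongrightarrow> 4 * (1 / (\<rho> - r) * 0)\<^sup>2 * exp (2 * growth_rate * t)"
    unfolding B_def by (intro tendsto_intros)
  moreover have "\<forall>\<^sub>F k in sequentially. \<forall>n.
      (\<integral>\<^sup>+\<omega>. ennreal ((moment n (\<xi> k t \<omega>) - moment n (\<eta> k t \<omega>))\<^sup>2) \<partial>M) \<le> ennreal (B k)"
  proof -
    \<comment> \<open>The value \<open>top\<close> is sent to 0 by \<open>enn2real\<close>, so
      \<open>w k\<close> bounds the initial moment differences only once the distance is known to be
      finite; hence the eventual form of the result.\<close>
    have "\<forall>\<^sub>F k in sequentially. wasserstein1 (\<mu>s k) \<mu> < top"
      using initial by (rule order_tendstoD) simp
    then show ?thesis
    proof (eventually_elim, intro allI)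
      fix k n assume fin: "wasserstein1 (\<mu>s k) \<mu> < top"
      have "(moment m (\<mu>s k) - moment m \<mu>)\<^sup>2 \<le> (w k)\<^sup>2" for m
      proof -
        have "ennreal \<bar>moment m (\<mu>s k) - moment m \<mu>\<bar> \<le> ennreal (1 / (\<rho> - r)) * wasserstein1 (\<mu>s k) \<mu>"
          by (rule moment_diff_wasserstein1_le[OF \<mu>s \<mu>])
        also have "\<dots> = ennreal (w k)"
          using fin radii by (simp only: w_def ennreal_mult'' enn2real_nonneg ennreal_enn2real)
        finally have "\<bar>moment m (\<mu>s k) - moment m \<mu>\<bar> \<le> w k"
          using radii by (simp add: w_def)
        then show ?thesis
          using power_mono[of "\<bar>moment m (\<mu>s k) - moment m \<mu>\<bar>" "w k" 2] by simp
      qed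
      from moment_diff_stability[OF u \<xi> \<eta> this t]
      show "(\<integral>\<^sup>+\<omega>. ennreal ((moment n (\<xi> k t \<omega>) - moment n (\<eta> k t \<omega>))\<^sup>2) \<partial>M) \<le> ennreal (B k)"
        by (simp add: B_def)
    qed
  qed
  ultimately show ?thesis
    using that[of B] by (simp add: B_def)
qed

text \<open>The approximating polynomial depends on \<open>f\<close> and \<open>e\<close> but not on
  \<open>k\<close>, so finitely many moment differences remain, each small in mean by its second
  moment.\<close>

theorem solution_integral_L1_tendsto:
  assumes f: "f \<in> bounded_continuous"
  shows "(\<lambda>k. \<integral>\<omega>. \<bar>(\<integral>x. f x \<partial>\<xi> k t \<omega>) - (\<integral>x. f x \<partial>\<eta> k t \<omega>)\<bar> \<partial>M) \<longlonglongrightarrow> 0"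
proof -
  obtain B where B: "B \<longlonglongrightarrow> 0" "\<And>k. 0 \<le> B k"
    and le: "\<forall>\<^sub>F k in sequentially. \<forall>n.
      (\<integral>\<^sup>+\<omega>. ennreal ((moment n (\<xi> k t \<omega>) - moment n (\<eta> k t \<omega>))\<^sup>2) \<partial>M) \<le> ennreal (B k)"
    using moment_diff_mean_square_bound by blast
  define d where "d i k \<omega> = moment i (\<xi> k t \<omega>) - moment i (\<eta> k t \<omega>)" for i k \<omega>
  have d_meas[measurable]: "d i k \<in> borel_measurable M" for i k
    unfolding d_def using solution_moment_measurable[OF \<xi> t] solution_moment_measurable[OF \<eta> t] by measurable
  have d_le: "\<bar>d i k \<omega>\<bar> \<le> 2" if "\<omega> \<in> space M" for i k \<omega>
    unfolding d_def using solution_in_P[OF \<xi> t that] solution_in_P[OF \<eta> t that] by (rule moment_diff_abs_le)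
  have d_int: "integrable M (\<lambda>\<omega>. \<bar>d i k \<omega>\<bar>)" for i k
    by (rule integrable_const_bound[of _ 2]) (use d_le in auto)
  show ?thesis
  proof (rule LIMSEQ_I)
    fix e :: real assume "0 < e"
    then obtain N c where c: "\<forall>i. 0 \<le> c i" "\<forall>\<nu>\<in>\<P>. \<forall>\<nu>'\<in>\<P>.
        \<bar>(\<integral>x. f x \<partial>\<nu>) - (\<integral>x. f x \<partial>\<nu>')\<bar> \<le> e / 2 + (\<Sum>i\<le>N. c i * \<bar>moment i \<nu> - moment i \<nu>'\<bar>)"
      using integral_diff_le_moments[OF f, of "e / 2"] half_gt_zero[of e] by blast
    have "(\<lambda>k. (\<Sum>i\<le>N. c i) * sqrt (B k)) \<longlonglongrightarrow> (\<Sum>i\<le>N. c i) * sqrt 0"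
      by (intro tendsto_intros B)
    then have "\<forall>\<^sub>F k in sequentially. (\<Sum>i\<le>N. c i) * sqrt (B k) < e / 2"
      using \<open>0 < e\<close> by (intro order_tendstoD) auto
    with le have "\<forall>\<^sub>F k in sequentially.
        norm ((\<integral>\<omega>. \<bar>(\<integral>x. f x \<partial>\<xi> k t \<omega>) - (\<integral>x. f x \<partial>\<eta> k t \<omega>)\<bar> \<partial>M) - 0) < e"
    proof eventually_elim
      case (elim k)
      have "(\<integral>\<omega>. \<bar>(\<integral>x. f x \<partial>\<xi> k t \<omega>) - (\<integral>x. f x \<partial>\<eta> k t \<omega>)\<bar> \<partial>M)
          \<le> (\<integral>\<omega>. e / 2 + (\<Sum>i\<le>N. c i * \<bar>d i k \<omega>\<bar>) \<partial>M)"
      proof (rule integral_mono')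
        show "integrable M (\<lambda>\<omega>. e / 2 + (\<Sum>i\<le>N. c i * \<bar>d i k \<omega>\<bar>))"
          using d_int by auto
        show "\<bar>(\<integral>x. f x \<partial>\<xi> k t \<omega>) - (\<integral>x. f x \<partial>\<eta> k t \<omega>)\<bar> \<le> e / 2 + (\<Sum>i\<le>N. c i * \<bar>d i k \<omega>\<bar>)"
          if "\<omega> \<in> space M" for \<omega>
          unfolding d_def using solution_in_P[OF \<xi> t that] solution_in_P[OF \<eta> t that] by (rule c(2)[rule_format])
        show "0 \<le> e / 2 + (\<Sum>i\<le>N. c i * \<bar>d i k \<omega>\<bar>)" for \<omega>
          using \<open>0 < e\<close> c(1) by (intro add_nonneg_nonneg sum_nonneg mult_nonneg_nonneg) auto
      qed
      also have "\<dots> = e / 2 + (\<Sum>i\<le>N. c i * (\<integral>\<omega>. \<bar>d i k \<omega>\<bar> \<partial>M))"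
        using d_int by (simp add: prob_space)
      also have "\<dots> \<le> e / 2 + (\<Sum>i\<le>N. c i * sqrt (B k))"
      proof (rule add_left_mono, rule sum_mono)
        fix i
        have "(\<integral>\<omega>. \<bar>d i k \<omega>\<bar> \<partial>M) \<le> sqrt (B k)"
        proof (rule expectation_abs_le_sqrt[OF d_meas d_le _ B(2)])
          show "(\<integral>\<^sup>+\<omega>. ennreal ((d i k \<omega>)\<^sup>2) \<partial>M) \<le> ennreal (B k)"
            using elim(1) unfolding d_def by blast
        qed
        then show "c i * (\<integral>\<omega>. \<bar>d i k \<omega>\<bar> \<partial>M) \<le> c i * sqrt (B k)"
          using c(1) by (intro mult_left_mono) auto
      qed
      also have "\<dots> < e"
        using elim(2) unfolding sum_distrib_right by linarith
      finally show ?case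
        by (simp add: integral_nonneg_AE)
    qed
    then show "\<exists>no. \<forall>k\<ge>no.
        norm ((\<integral>\<omega>. \<bar>(\<integral>x. f x \<partial>\<xi> k t \<omega>) - (\<integral>x. f x \<partial>\<eta> k t \<omega>)\<bar> \<partial>M) - 0) < e"
      by (simp add: eventually_sequentially)
  qed
qed

text \<open>The weighted sum \<open>D\<close> replaces a diagonal argument: it tends to 0 in mean,
  hence almost surely along one deterministic subsequence, and it controls every moment
  simultaneously.\<close>

theorem solution_wasserstein1_AE_subseq:
  "\<exists>p. strict_mono p \<and> (AE \<omega> in M. (\<lambda>k. wasserstein1 (\<xi> (p k) t \<omega>) (\<eta> (p k) t \<omega>)) \<longlonglongrightarrow> 0)"
proof -
  obtain B where B: "B \<longlonglongrightarrow> 0" "\<And>k. 0 \<le> B k"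
    and le: "\<forall>\<^sub>F k in sequentially. \<forall>n.
      (\<integral>\<^sup>+\<omega>. ennreal ((moment n (\<xi> k t \<omega>) - moment n (\<eta> k t \<omega>))\<^sup>2) \<partial>M) \<le> ennreal (B k)"
    using moment_diff_mean_square_bound by blast
  define d where "d i k \<omega> = moment i (\<xi> k t \<omega>) - moment i (\<eta> k t \<omega>)" for i k \<omega>
  have d_meas[measurable]: "d i k \<in> borel_measurable M" for i k
    unfolding d_def using solution_moment_measurable[OF \<xi> t] solution_moment_measurable[OF \<eta> t] by measurable
  have d_le: "\<bar>d i k \<omega>\<bar> \<le> 2" if "\<omega> \<in> space M" for i k \<omega>
    unfolding d_def using solution_in_P[OF \<xi> t that] solution_in_P[OF \<eta> t that] by (rule moment_diff_abs_le)
  define D where "D k \<omega> = (\<Sum>i. q ^ i * (d i k \<omega>)\<^sup>2)" for k \<omega>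
  have D_meas[measurable]: "D k \<in> borel_measurable M" for k
    unfolding D_def by measurable
  have summ: "summable (\<lambda>i. q ^ i * (d i k \<omega>)\<^sup>2)" if "\<omega> \<in> space M" for k \<omega>
  proof (rule geometric_weight_summable[OF q_bounds])
    show "\<bar>(d i k \<omega>)\<^sup>2\<bar> \<le> 2\<^sup>2" for i
      using power_mono[OF d_le[OF that, of i k], of 2] by simp
  qed
  have term_le: "q ^ i * (d i k \<omega>)\<^sup>2 \<le> D k \<omega>" if "\<omega> \<in> space M" for i k \<omega>
    unfolding D_def using sum_le_suminf[OF summ[OF that], of "{i}" k] q_bounds by simp
  have D_nonneg: "0 \<le> D k \<omega>" if "\<omega> \<in> space M" for k \<omega>
    using order_trans[OF _ term_le[OF that, of 0]] by simp
  have D_int: "integrable M (D k)" for k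
  proof (rule integrable_const_bound)
    show "AE \<omega> in M. norm (D k \<omega>) \<le> (\<Sum>i. q ^ i * 2\<^sup>2)"
    proof (rule AE_I2)
      fix \<omega> assume \<omega>: "\<omega> \<in> space M"
      have "D k \<omega> \<le> (\<Sum>i. q ^ i * 2\<^sup>2)"
        unfolding D_def
      proof (rule suminf_le[OF _ summ[OF \<omega>]])
        show "q ^ i * (d i k \<omega>)\<^sup>2 \<le> q ^ i * 2\<^sup>2" for i
          using power_mono[OF d_le[OF \<omega>, of i k], of 2] q_bounds by (intro mult_left_mono) auto
        show "summable (\<lambda>i. q ^ i * 2\<^sup>2)"
          by (rule geometric_weight_summable[OF q_bounds, of _ 4]) simp
      qed
      then show "norm (D k \<omega>) \<le> (\<Sum>i. q ^ i * 2\<^sup>2)"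
        using D_nonneg[OF \<omega>] by simp
    qed
  qed measurable
  have "\<forall>\<^sub>F k in sequentially. norm (\<integral>\<omega>. norm (D k \<omega>) \<partial>M) \<le> B k / (1 - q)"
    using le
  proof eventually_elim
    case (elim k)
    have "(\<integral>\<^sup>+\<omega>. ennreal (D k \<omega>) \<partial>M) \<le> ennreal (B k / (1 - q))"
      unfolding D_def using elim
      by (intro nn_integral_geometric_weight_le[of "\<lambda>i. d i k" 2] d_meas d_le B) (auto simp: d_def)
    then have "(\<integral>\<omega>. D k \<omega> \<partial>M) \<le> B k / (1 - q)"
      using D_nonneg q_bounds B(2) by (subst (asm) nn_integral_eq_integral[OF D_int]) (auto intro: AE_I2)
    moreover have "(\<integral>\<omega>. norm (D k \<omega>) \<partial>M) = (\<integral>\<omega>. D k \<omega> \<partial>M)"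
      using D_nonneg by (intro Bochner_Integration.integral_cong) auto
    moreover have "0 \<le> (\<integral>\<omega>. norm (D k \<omega>) \<partial>M)"
      by (rule integral_nonneg_AE) simp
    ultimately show ?case
      by simp
  qed
  then have "(\<lambda>k. \<integral>\<omega>. norm (D k \<omega>) \<partial>M) \<longlonglongrightarrow> 0"
    by (rule Lim_null_comparison)
       (use tendsto_divide[OF B(1) tendsto_const, of "1 - q"] q_bounds in simp)
  from tendsto_L1_AE_subseq[OF D_int this]
  obtain p where p: "strict_mono p" "AE \<omega> in M. (\<lambda>k. D (p k) \<omega>) \<longlonglongrightarrow> 0"
    by auto
  have q_pos: "0 < q"
    using radii by (simp add: q_def)
  have "AE \<omega> in M. \<omega> \<in> space M"
    by simp
  with p(2) have "AE \<omega> in M. (\<lambda>k. wasserstein1 (\<xi> (p k) t \<omega>) (\<eta> (p k) t \<omega>)) \<longlonglongrightarrow> 0"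
  proof eventually_elim
    case (elim \<omega>)
    show ?case
    proof (rule moments_wasserstein1_tendsto)
      show "\<xi> (p k) t \<omega> \<in> \<P>" "\<eta> (p k) t \<omega> \<in> \<P>" for k
        using solution_in_P[OF \<xi> t elim(2)] solution_in_P[OF \<eta> t elim(2)] by auto
      fix n
      \<comment> \<open>A term of a nonnegative series is at most its sum, so dividing by the fixed
        positive weight \<open>q ^ n\<close> recovers the \<open>n\<close>-th moment
        difference.\<close>
      have "(\<lambda>k. D (p k) \<omega> / q ^ n) \<longlonglongrightarrow> 0 / q ^ n"
        using elim(1) q_pos by (intro tendsto_divide tendsto_const) auto
      then have D_lim: "(\<lambda>k. D (p k) \<omega> / q ^ n) \<longlonglongrightarrow> 0"
        by simp
      have "norm ((d n (p k) \<omega>)\<^sup>2) \<le> D (p k) \<omega> / q ^ n" for k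
        using term_le[OF elim(2), of n "p k"] q_pos by (simp add: pos_le_divide_eq mult.commute)
      then have "(\<lambda>k. (d n (p k) \<omega>)\<^sup>2) \<longlonglongrightarrow> 0"
        by (intro Lim_null_comparison[OF always_eventually D_lim] allI)
      then have "(\<lambda>k. d n (p k) \<omega>) \<longlonglongrightarrow> 0"
        using tendsto_real_sqrt[of "\<lambda>k. (d n (p k) \<omega>)\<^sup>2" 0] by (simp add: tendsto_rabs_zero_iff)
      then show "(\<lambda>k. moment n (\<xi> (p k) t \<omega>) - moment n (\<eta> (p k) t \<omega>)) \<longlonglongrightarrow> 0"
        by (simp add: d_def)
    qed
  qed
  with p(1) show ?thesis
    by blast
qed

end

end

theorem theorem4p3:
  fixes \<mu>0 \<mu> :: "real measure" and \<mu>s :: "nat \<Rightarrow> real measure"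
    and R K :: real and U :: "(nat \<Rightarrow> real) set"
    and M :: "'a measure" and F :: "real \<Rightarrow> 'a measure" and W :: "real \<Rightarrow> 'a \<Rightarrow> real"
    and u :: "nat \<Rightarrow> real \<Rightarrow> 'a \<Rightarrow> nat \<Rightarrow> real"
    and \<xi> \<eta> :: "nat \<Rightarrow> real \<Rightarrow> 'a \<Rightarrow> real measure"
  assumes "prob_space \<mu>0" and "sets \<mu>0 = sets borel"
    and "compact (measure_support \<mu>0)"
    and "R > 0" and "measure_support \<mu>0 \<subseteq> {-R<..<R}"
    and "K > 0" and "control_set R K U"
    and "\<mu> \<in> prob_measures_within \<mu>0"
    and "\<And>k. \<mu>s k \<in> prob_measures_within \<mu>0"
    and "(\<lambda>k. wasserstein1 (\<mu>s k) \<mu>) \<longlonglongrightarrow> 0"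
    and "usual_filtered_prob_space M F"
    and "brownian_motion M F W"
    and "\<And>k. progressively_measurable F (restrict_space borel U) (u k)"
    and "\<And>k. mvm_solution M F W \<mu>0 (u k) (\<mu>s k) (\<xi> k)"
    and "\<And>k. mvm_solution M F W \<mu>0 (u k) \<mu> (\<eta> k)"
  shows "(\<forall>k \<zeta>. mvm_solution M F W \<mu>0 (u k) (\<mu>s k) \<zeta> \<longrightarrow> indistinguishable M \<zeta> (\<xi> k)) \<and>
         (\<forall>k \<zeta>. mvm_solution M F W \<mu>0 (u k) \<mu> \<zeta> \<longrightarrow> indistinguishable M \<zeta> (\<eta> k)) \<and>
         (\<forall>t>0. \<forall>f\<in>bounded_continuous.
            (\<lambda>k. \<integral>\<omega>. \<bar>(\<integral>x. f x \<partial>(\<xi> k t \<omega>)) - (\<integral>x. f x \<partial>(\<eta> k t \<omega>))\<bar> \<partial>M) \<longlonglongrightarrow> 0) \<and>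
         (\<forall>t>0. \<exists>r. strict_mono r \<and>
            (AE \<omega> in M. (\<lambda>k. wasserstein1 (\<xi> (r k) t \<omega>) (\<eta> (r k) t \<omega>)) \<longlonglongrightarrow> 0))"
proof -
  obtain r where r: "0 < r" "r < R" "measure_support \<mu>0 \<subseteq> {-r..r}"
    using compact_subset_smaller_interval assms by metis
  \<comment> \<open>The midpoint provides a radius \<rho> strictly between \<open>r\<close> and
    \<open>R\<close>.\<close>
  interpret controlled_equation M F W \<mu>0 r "(r + R) / 2" R K U
    using assms r by unfold_locales auto
  note setting = assms(13,14,15,9,8,10)
  show ?thesis
  proof (intro conjI allI impI ballI)
    show "indistinguishable M \<zeta> (\<xi> k)" if "mvm_solution M F W \<mu>0 (u k) (\<mu>s k) \<zeta>" for k \<zeta>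
      by (rule solution_unique[OF assms(13) that assms(14)])
    show "indistinguishable M \<zeta> (\<eta> k)" if "mvm_solution M F W \<mu>0 (u k) \<mu> \<zeta>" for k \<zeta>
      by (rule solution_unique[OF assms(13) that assms(15)])
    fix t :: real assume "t > 0"
    then have "0 \<le> t"
      by simp
    note at_t = setting this
    show "(\<lambda>k. \<integral>\<omega>. \<bar>(\<integral>x. f x \<partial>(\<xi> k t \<omega>)) - (\<integral>x. f x \<partial>(\<eta> k t \<omega>))\<bar> \<partial>M) \<longlonglongrightarrow> 0"
      if "f \<in> bounded_continuous" for f
      by (rule solution_integral_L1_tendsto[OF at_t that])
    show "\<exists>r. strict_mono r \<and>
        (AE \<omega> in M. (\<lambda>k. wasserstein1 (\<xi> (r k) t \<omega>) (\<eta> (r k) t \<omega>)) \<longlonglongrightarrow> 0)"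
      by (rule solution_wasserstein1_AE_subseq[OF at_t])
  qed
qed

end
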